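(* Let $n\in\{3,4\}$ and let $k\ge1$ be an integer. Then the radius of convergence of the Taylor series at $q=0$ of $[n,n,\ldots,n]_q$ ($k$ entries, all equal to $n$) is greater than the radius of convergence of the power series $[n,n,\ldots,n,\ldots]_q$ (the $q$-deformation of the $n$th metallic number $\frac{n+\sqrt{n^2+4}}2$).
   Context: **Regular continued fractions.** $[a_1,a_2,\ldots,a_k]=a_1+\cfrac{1}{a_2+\cfrac{1}{\ddots+\cfrac{1}{a_k}}}$ with integers $a_i\ge 1$. Since $[a_1,\ldots,a_k]=[a_1,\ldots,a_k-1,1]$ (when $a_k\ge2$) and $[a_1,\ldots,a_{k-1},1]=[a_1,\ldots,a_{k-1}+1]$, every rational number $>1$ has a unique such expansion of even length $2m$. **$q$-integers.** $[0]_q=0$ and $[a]_q=1+q+\cdots+q^{a-1}$ for an integer $a\ge1$; $[a]_{q^{-1}}=1+q^{-1}+\cdots+q^{-(a-1)}$. **$q$-rationals (Morier-Genoud and Ovsienko).** For a rational $\frac rs=[a_1,\ldots,a_{2m}]>1$ (even-length expansion), $$\left[\frac rs\right]_q=[a_1]_q+\cfrac{q^{a_1}}{[a_2]_{q^{-1}}+\cfrac{q^{-a_2}}{[a_3]_q+\cfrac{q^{a_3}}{[a_4]_{q^{-1}}+\cfrac{q^{-a_4}}{\ddots+\cfrac{q^{a_{2m-1}}}{[a_{2m}]_{q^{-1}}}}}}},$$ a rational function of $q$, regarded as a power series in $q$ via its Taylor expansion at $q=0$. (For a positive integer this gives the $q$-integer.) For any finite continued fraction, $[n,\ldots,n]_q$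 denotes the $q$-deformation of the rational number $[n,\ldots,n]$. The radius of convergence is $+\infty$ if the series is a polynomial. **$q$-irrationals.** For an irrational $x>1$ and any sequence of rationals $x_k\to x$, write $[x_k]_q=\sum_{s\ge0}\varkappa_{k,s}q^s$. It is known (Morier-Genoud and Ovsienko) that for each $s$ the coefficients $\varkappa_{k,s}$ stabilize as $k\to\infty$ to an integer $\varkappa_s$ that does not depend on the chosen sequence; one defines $[x]_q=\sum_{s\ge0}\varkappa_sq^s$. For $x=[n,n,\ldots,n,\ldots]=\frac{n+\sqrt{n^2+4}}2$ the series $[x]_q$ satisfies $q[x]_q^2-\big((q-1)(q^n+1)+q[n]_q\big)[x]_q-1=0$. *)

theory Defs
  imports "HOL-Computational_Algebra.Formal_Laurent_Series" "HOL-Analysis.FPS_Convergence"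
begin

fun cfrac :: "nat list \<Rightarrow> rat" where
  "cfrac [] = 0"
| "cfrac [a] = of_nat a"
| "cfrac (a # b # bs) = of_nat a + 1 / cfrac (b # bs)"

text \<open>Meaningful for rationals greater than 1 only: these have exactly one such expansion.\<close>

definition even_expansion :: "rat \<Rightarrow> nat list" where
  "even_expansion x =
     (THE as. as \<noteq> [] \<and> even (length as) \<and> (\<forall>a\<in>set as. a \<ge> 1) \<and> cfrac as = x)"

definition q_int :: "'a::field \<Rightarrow> nat \<Rightarrow> 'a" where
  "q_int q a = (\<Sum>i<a. q ^ i)"

text \<open>The parameter alternates between \<open>q\<close> and \<open>inverse q\<close> from one level of the
  fraction to the next: odd levels contribute \<open>q_int q a\<close> and \<open>q ^ a\<close>, even levels
  \<open>q_int (inverse q) a\<close> and \<open>inverse q ^ a\<close>.\<close>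

fun q_cfrac :: "'a::field \<Rightarrow> nat list \<Rightarrow> 'a" where
  "q_cfrac q [] = 0"
| "q_cfrac q [a] = q_int q a"
| "q_cfrac q (a # b # bs) = q_int q a + q ^ a / q_cfrac (inverse q) (b # bs)"

text \<open>The rational function is computed in the field of formal Laurent series with \<open>q\<close> the
  formal variable, that is, through the embedding of rational functions by Laurent expansion
  at 0. For rationals greater than 1 there is no pole at 0, so \<open>fls_regpart\<close> only changes
  the type and yields the Taylor series.\<close>

definition q_rational :: "rat \<Rightarrow> complex fps" where
  "q_rational x = fls_regpart (q_cfrac fls_X (even_expansion x))"

text \<open>For irrational \<open>x > 1\<close>. A sequence of rationals tending to \<open>x\<close> may start with terms
  that are at most 1; they do not affect the eventual value.\<close>

definition q_irrational :: "real \<Rightarrow> complex fps" where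
  "q_irrational x = Abs_fps (\<lambda>s. THE c. \<forall>X :: nat \<Rightarrow> rat.
     (\<lambda>k. of_rat (X k)) \<longlonglongrightarrow> x \<longrightarrow>
     (\<forall>\<^sub>F k in sequentially. fps_nth (q_rational (X k)) s = c))"

definition metallic :: "nat \<Rightarrow> real" where
  "metallic n = (real n + sqrt (real n ^ 2 + 4)) / 2"

end

theory Submission
  imports Defs "HOL-Complex_Analysis.Complex_Analysis"
    "HOL-Computational_Algebra.Fundamental_Theorem_Algebra"
begin

text \<open>
  One period \<open>[n, n]\<close> of the continued fraction acts on Taylor series as a Moebius map \<open>G\<close> of
  determinant \<open>q\<^bsup>2n\<^esup>\<close>, so the \<open>q\<close>-metallic number is the fixed point of \<open>G\<close> and the finite
  fractions are iterates of \<open>G\<close>, started at \<open>[n]\<^sub>q\<close> for odd \<open>k\<close> and at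
  \<open>[n]\<^sub>q + q\<^bsup>2n-1\<^esup> / [n]\<^sub>q\<close> for even \<open>k\<close>. Let \<open>D\<close> be the discriminant of the fixed point equation
  and \<open>R\<close> the smallest modulus of a zero of \<open>D\<close>. That zero is simple, hence a branch point of the
  fixed point, whose radius of convergence is therefore at most \<open>R\<close>.

  It remains to see that no iterate has a pole in \<open>|q| \<le> R\<close>. With \<open>t\<close> the trace of \<open>G\<close> and
  \<open>e = q [n]\<^sub>q - (q - 1) (q\<^sup>n + 1)\<close> one has \<open>D = e\<^sup>2 + 4 q\<^bsup>2n+1\<^esup>\<close> and
  \<open>[n]\<^sub>q\<^sup>2 D = t\<^sup>2 - 4 q\<^bsup>2n\<^esup>\<close>. Poles are excluded once a branch of \<open>\<surd>D\<close> satisfies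
  \<open>Re (\<surd>D / e) > 0\<close> and \<open>Re ([n]\<^sub>q \<surd>D / t) > 0\<close>: the starting point is then closer to the
  attracting fixed point than to the repelling one. These inequalities can only fail where
  \<open>-4 q\<^bsup>2n+1\<^esup> / e\<^sup>2\<close> or \<open>4 q\<^bsup>2n\<^esup> / t\<^sup>2\<close> lies in \<open>[1, \<infinity>)\<close>. Since \<open>e\<close> and \<open>t\<close> have no zeros in
  \<open>|q| \<le> R\<close> for \<open>n = 3, 4\<close>, both quotients are starlike there. A quotient with a value above 1 at a point of the
  disc therefore takes the value 1 at a point closer to 0, and that point is a zero of \<open>D\<close>,
  against the minimality of \<open>R\<close>.
\<close>

subsection \<open>Starlike quotients\<close>

text \<open>Linear factors are split off one at a time; \<open>ws\<close> lists the roots with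
  multiplicity.\<close>

lemma complex_poly_log_deriv:
  fixes p :: "complex poly"
  shows "\<exists>ws. length ws = degree p \<and> (p \<noteq> 0 \<longrightarrow> (\<forall>w\<in>set ws. poly p w = 0)) \<and>
     (\<forall>z. poly p z \<noteq> 0 \<longrightarrow> poly (pderiv p) z / poly p z = (\<Sum>w\<leftarrow>ws. 1 / (z - w)))"
proof (induction "degree p" arbitrary: p)
  case 0
  then obtain c where "p = [:c:]" using degree_0_id by metis
  then show ?case by (auto simp: pderiv_pCons)
next
  case (Suc d)
  obtain w where w: "poly p w = 0"
    using alg_closed_imp_poly_has_root[of p] Suc.hyps(2) by auto
  then obtain r where p: "p = [:-w, 1:] * r" using poly_eq_0_iff_dvd by (metis dvdE)
  have "r \<noteq> 0" using p Suc.hyps(2) by auto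
  then have "degree p = Suc (degree r)" using p by (subst p, subst degree_mult_eq) auto
  then have "d = degree r" using Suc.hyps(2) by simp
  from Suc.hyps(1)[OF this] obtain ws where ws: "length ws = degree r"
    "\<forall>v\<in>set ws. poly r v = 0"
    "\<And>z. poly r z \<noteq> 0 \<Longrightarrow> poly (pderiv r) z / poly r z = (\<Sum>v\<leftarrow>ws. 1 / (z - v))"
    using \<open>r \<noteq> 0\<close> by blast
  have "poly (pderiv p) z / poly p z = (\<Sum>v\<leftarrow>w # ws. 1 / (z - v))" if "poly p z \<noteq> 0" for z
  proof -
    have nz: "z - w \<noteq> 0" "poly r z \<noteq> 0" using that p by auto
    have "poly (pderiv p) z / poly p z = ((z - w) * poly (pderiv r) z + poly r z) / ((z - w) * poly r z)"
      unfolding p pderiv_mult by (simp add: pderiv_pCons algebra_simps)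
    also have "\<dots> = 1 / (z - w) + poly (pderiv r) z / poly r z"
      using nz by (simp add: field_simps)
    finally show ?thesis using ws(3)[OF nz(2)] by simp
  qed
  moreover have "\<forall>v\<in>set (w # ws). poly p v = 0" using w ws(2) p by auto
  moreover have "length (w # ws) = degree p" using ws(1) \<open>degree p = Suc (degree r)\<close> by simp
  ultimately show ?case by blast
qed

text \<open>Every root lies farther from 0 than \<open>z\<close> and contributes less than 1/2 to
  the real part. This is the starlikeness of \<open>z ^ N / a(z)\<^sup>2\<close>, whose logarithmic
  derivative times \<open>z\<close> is \<open>N - 2 z a'(z) / a(z)\<close>.\<close>

lemma Re_log_deriv_zero_free_disc:
  fixes a :: "complex poly"
  assumes zf: "\<And>w. norm w \<le> norm z \<Longrightarrow> poly a w \<noteq> 0" and "degree a \<le> N" "0 < N"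
  shows "2 * Re (z * poly (pderiv a) z / poly a z) < real N"
proof -
  have "a \<noteq> 0" using zf[of z] by auto
  with complex_poly_log_deriv[of a] obtain ws where ws: "length ws = degree a"
    "\<forall>w\<in>set ws. poly a w = 0"
    "\<And>z. poly a z \<noteq> 0 \<Longrightarrow> poly (pderiv a) z / poly a z = (\<Sum>w\<leftarrow>ws. 1 / (z - w))"
    by blast
  have root: "2 * Re (z / (z - w)) < 1" if "norm z < norm w" for w
  proof -
    have nz: "z - w \<noteq> 0" using that by auto
    then have pos: "0 < (norm (z - w))\<^sup>2" by simp
    have "(norm z)\<^sup>2 < (norm w)\<^sup>2" using that by (simp add: power_strict_mono)
    \<comment> \<open>Expanding \<open>w = z - (z - w)\<close> gives \<open>2 Re (z cnj (z - w)) =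
      |z|\<^sup>2 + |z - w|\<^sup>2 - |w|\<^sup>2\<close>.\<close>
    then have "2 * Re (z * cnj (z - w)) < (norm (z - w))\<^sup>2"
      unfolding cmod_power2 by (simp add: power2_eq_square algebra_simps)
    moreover have "Re (z / (z - w)) = Re (z * cnj (z - w)) / (norm (z - w))\<^sup>2"
      by (subst complex_div_cnj) (simp only: Re_divide_of_real flip: of_real_power)
    ultimately show ?thesis using pos by (simp only: pos_divide_less_eq times_divide_eq_right mult_1)
  qed
  \<comment> \<open>Strictness needs at least one root, so the induction carries both bounds; for a
    constant polynomial it comes from \<open>0 < N\<close>.\<close>
  have "2 * Re (\<Sum>w\<leftarrow>ws. z / (z - w)) \<le> real (length ws) \<and>
      (ws \<noteq> [] \<longrightarrow> 2 * Re (\<Sum>w\<leftarrow>ws. z / (z - w)) < real (length ws))"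
    if "\<forall>w\<in>set ws. poly a w = 0" for ws
    using that
  proof (induction ws)
    case (Cons w ws)
    have "2 * Re (z / (z - w)) < 1"
      by (rule root) (metis Cons.prems zf linorder_not_le list.set_intros(1))
    then show ?case using Cons by auto
  qed simp
  from this[OF ws(2)] have "2 * Re (\<Sum>w\<leftarrow>ws. z / (z - w)) < real N"
    using assms(2,3) ws(1) by (cases "ws = []") auto
  moreover have "z * poly (pderiv a) z / poly a z = (\<Sum>w\<leftarrow>ws. z / (z - w))"
  proof -
    have "z * (poly (pderiv a) z / poly a z) = (\<Sum>w\<leftarrow>ws. z * (1 / (z - w)))"
      using ws(3)[of z] zf[of z] by (simp only: sum_list_const_mult order_refl simp_thms)
    then show ?thesis by simp
  qed
  ultimately show ?thesis by simp
qed

text \<open>If all roots had distance at least \<delta> from \<open>z\<close>, then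
  \<open>p' / p\<close> would be a sum of \<open>degree p\<close> terms of modulus at most
  1/\<delta>. This turns an approximate zero into a true one.\<close>

lemma exists_root_near:
  fixes p :: "complex poly"
  assumes "p \<noteq> 0" "0 < \<delta>" and small: "real (degree p) * norm (poly p z) < \<delta> * norm (poly (pderiv p) z)"
  shows "\<exists>w. poly p w = 0 \<and> norm (z - w) < \<delta>"
proof (rule ccontr)
  assume "\<not> ?thesis"
  then have far: "\<delta> \<le> norm (z - w)" if "poly p w = 0" for w using that not_le by blast
  have nz: "poly p z \<noteq> 0" using far[of z] \<open>0 < \<delta>\<close> by auto
  from complex_poly_log_deriv[of p] obtain ws where ws: "length ws = degree p"
    "\<forall>w\<in>set ws. poly p w = 0"
    "poly (pderiv p) z / poly p z = (\<Sum>w\<leftarrow>ws. 1 / (z - w))"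
    using nz \<open>p \<noteq> 0\<close> by blast
  have "\<delta> * norm (\<Sum>w\<leftarrow>ws. 1 / (z - w)) \<le> real (length ws)"
    if "\<forall>w\<in>set ws. poly p w = 0" for ws
    using that
  proof (induction ws)
    case (Cons w ws)
    have "\<delta> * norm (1 / (z - w)) \<le> 1"
      using far[of w] Cons.prems \<open>0 < \<delta>\<close> by (auto simp: norm_divide divide_simps)
    moreover have "\<delta> * norm (\<Sum>w\<leftarrow>w # ws. 1 / (z - w))
        \<le> \<delta> * (norm (1 / (z - w)) + norm (\<Sum>w\<leftarrow>ws. 1 / (z - w)))"
      using \<open>0 < \<delta>\<close> norm_triangle_ineq by simp
    moreover have "\<delta> * norm (\<Sum>w\<leftarrow>ws. 1 / (z - w)) \<le> real (length ws)"
      using Cons by simp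
    ultimately show ?case by (simp add: algebra_simps)
  qed simp
  from this[OF ws(2)] have "\<delta> * norm (poly (pderiv p) z / poly p z) \<le> real (degree p)"
    using ws by simp
  then have "\<delta> * norm (poly (pderiv p) z) \<le> real (degree p) * norm (poly p z)"
    using nz by (simp add: norm_divide field_simps)
  then show False using small by simp
qed

text \<open>Let \<open>f\<close> be the local inverse of \<open>g\<close>. At \<open>s\<close> the
  derivative of \<open>|f x|\<^sup>2\<close> along the real line is
  \<open>2 Re (cnj z / g'(z))\<close>, which has the sign of \<open>Re (z g'(z))\<close>; lowering
  the value thus lowers the modulus.\<close>

lemma local_decrease_norm:
  fixes g :: "complex \<Rightarrow> complex"
  assumes hol: "g holomorphic_on U" and U: "open U" "z \<in> U"
    and z: "g z = of_real s" and star: "0 < Re (z * deriv g z)" and "r < s"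
  shows "\<exists>w s'. norm w < norm z \<and> g w = of_real s' \<and> r < s' \<and> s' < s"
proof -
  have d: "deriv g z \<noteq> 0" "z \<noteq> 0" using star by auto
  obtain \<delta> where \<delta>: "0 < \<delta>" "ball z \<delta> \<subseteq> U" "open (g ` ball z \<delta>)" "inj_on g (ball z \<delta>)"
    using has_complex_derivative_locally_invertible[OF hol U(2,1) d(1)] by blast
  obtain f where f: "f holomorphic_on (g ` ball z \<delta>)"
      "\<And>w. w \<in> ball z \<delta> \<Longrightarrow> deriv g w * deriv f (g w) = 1"
      "\<And>w. w \<in> ball z \<delta> \<Longrightarrow> f (g w) = w"
    using holomorphic_has_inverse[OF holomorphic_on_subset[OF hol \<delta>(2)] open_ball \<delta>(4)] by metis
  have zb: "z \<in> ball z \<delta>" using \<delta> by simp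
  have fs: "f (of_real s) = z" using f(3)[OF zb] z by simp
  have df: "(f has_field_derivative 1 / deriv g z) (at (of_real s))"
  proof -
    have "f field_differentiable at (of_real s)"
      using f(1) \<delta>(3) zb z by (metis holomorphic_on_imp_differentiable_at imageI)
    then have "(f has_field_derivative deriv f (of_real s)) (at (of_real s))"
      using field_differentiable_derivI by blast
    moreover have "deriv f (of_real s) = 1 / deriv g z"
      using f(2)[OF zb] z d by (simp add: field_simps)
    ultimately show ?thesis by simp
  qed
  define h where "h x = (Re (f (of_real x)))\<^sup>2 + (Im (f (of_real x)))\<^sup>2" for x :: real
  define c where "c = 1 / deriv g z"
  have vec: "((\<lambda>x. f (of_real x)) has_vector_derivative c) (at s)"
    using df unfolding c_def by (rule has_vector_derivative_real_field)
  have dh: "(h has_real_derivative 2 * Re (cnj z * c)) (at s)"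
  proof -
    have re: "((\<lambda>x. Re (f (of_real x))) has_real_derivative Re c) (at s)"
      and im: "((\<lambda>x. Im (f (of_real x))) has_real_derivative Im c) (at s)"
      using vec by (auto simp: has_vector_derivative_complex_iff)
    show ?thesis unfolding h_def
      by (rule derivative_eq_intros re im refl)+ (simp add: fs algebra_simps)
  qed
  have "0 < Re (cnj z * c)"
  proof -
    define v where "v = 1 / (z * deriv g z)"
    have "cnj z * c = of_real ((norm z)\<^sup>2) * v"
      using d by (simp add: c_def v_def complex_norm_square del: of_real_power)
    moreover have "0 < Re v"
      using star d by (simp add: v_def Re_divide flip: cmod_power2 del: times_complex.sel)
    ultimately show ?thesis using d by (simp del: of_real_power)
  qed
  then obtain \<eta> where \<eta>: "0 < \<eta>" "\<And>x. 0 < x \<Longrightarrow> x < \<eta> \<Longrightarrow> h (s - x) < h s"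
    using DERIV_pos_inc_left[OF dh] by auto
  obtain \<epsilon> where \<epsilon>: "0 < \<epsilon>" "ball (of_real s) \<epsilon> \<subseteq> g ` ball z \<delta>"
    using \<delta>(3) zb z by (metis imageI open_contains_ball)
  define x where "x = min (min \<eta> \<epsilon>) (s - r) / 2"
  have x: "0 < x" "x < \<eta>" "x < \<epsilon>" "x < s - r" using \<eta> \<epsilon> \<open>r < s\<close> by (auto simp: x_def)
  have "of_real (s - x) \<in> g ` ball z \<delta>"
    using \<epsilon>(2) x by (force simp: dist_norm simp flip: of_real_diff)
  then obtain w where w: "w \<in> ball z \<delta>" "g w = of_real (s - x)" by (metis imageE)
  have "f (of_real (s - x)) = w" using f(3)[OF w(1)] w(2) by simp
  then have "(norm w)\<^sup>2 < (norm z)\<^sup>2"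
    using \<eta>(2)[OF x(1,2)] fs by (simp add: h_def cmod_power2)
  then have "norm w < norm z" by (simp add: power2_less_imp_less)
  then show ?thesis using w(2) x by (intro exI[of _ w] exI[of _ "s - x"]) auto
qed

text \<open>\<open>g z = c z\<^sup>N / a(z)\<^sup>2\<close> is starlike, so a point of smallest modulus with \<open>g z \<ge> 1\<close> real
  must satisfy \<open>g z = 1\<close>: otherwise lowering the value of \<open>g\<close> would lower the modulus.\<close>

lemma starlike_quotient_avoids_ray:
  fixes a :: "complex poly"
  assumes "0 < N" "degree a \<le> N"
    and zf: "\<And>z. norm z \<le> R \<Longrightarrow> poly a z \<noteq> 0"
    and ne: "\<And>z. norm z < R \<Longrightarrow> c * z ^ N \<noteq> poly a z ^ 2"
    and z0: "norm z0 \<le> R" and "1 < s"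
  shows "c * z0 ^ N \<noteq> of_real s * poly a z0 ^ 2"
proof
  assume eq: "c * z0 ^ N = of_real s * poly a z0 ^ 2"
  define g where "g z = c * z ^ N / poly a z ^ 2" for z
  \<comment> \<open>Capping the values at \<open>s\<close>, the value at \<open>z0\<close>, makes
    \<open>K\<close> compact and keeps \<open>z0\<close> in it.\<close>
  define K where "K = cball 0 R \<inter> g -` (of_real ` {1..s})"
  have cont: "continuous_on (cball 0 R) g"
    unfolding g_def using zf by (auto intro!: continuous_intros)
  have "compact (of_real ` {1..s} :: complex set)"
    by (intro compact_continuous_image continuous_intros) auto
  then have "closed K"
    unfolding K_def by (intro continuous_closed_preimage[OF cont]) (auto intro: compact_imp_closed)
  then have "compact K"
    using compact_eq_bounded_closed by (metis K_def bounded_Int bounded_cball)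
  have z0K: "z0 \<in> K"
    using eq zf[OF z0] z0 \<open>1 < s\<close> by (auto simp: K_def g_def intro!: image_eqI[of _ _ s])
  then obtain z1 where z1: "z1 \<in> K" "\<And>z. z \<in> K \<Longrightarrow> norm z1 \<le> norm z"
    using continuous_attains_inf[OF \<open>compact K\<close>, of norm] by (auto intro: continuous_intros)
  have step: False if z: "z \<in> K" "\<And>w. w \<in> K \<Longrightarrow> norm z \<le> norm w" "g z \<noteq> 1" for z
  proof -
    obtain u where u: "g z = of_real u" "1 \<le> u" "u \<le> s" using z(1) by (auto simp: K_def)
    have u1: "1 < u" using u z(3) by (cases "u = 1") auto
    have zR: "norm z \<le> R" using z(1) by (simp add: K_def)
    have z0': "z \<noteq> 0" using u u1 \<open>0 < N\<close> by (cases "z = 0") (simp_all add: g_def zero_power)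
    have az: "poly a z \<noteq> 0" using zf zR by blast
    define U where "U = - {z. poly a z = 0}"
    have U: "open U" "z \<in> U"
      using az unfolding U_def by (auto intro!: open_Compl finite_imp_closed poly_roots_finite)
    have hol: "g holomorphic_on U"
      unfolding g_def U_def by (auto intro!: holomorphic_intros)
    have "c \<noteq> 0" using u u1 by (auto simp: g_def)
    have "(g has_field_derivative
       (c * (of_nat N * z ^ (N - 1)) * poly a z ^ 2 - c * z ^ N * (2 * poly a z * poly (pderiv a) z))
         / (poly a z ^ 2 * poly a z ^ 2)) (at z)"
      unfolding g_def using az by (auto intro!: derivative_eq_intros poly_DERIV)
    then have dg: "deriv g z =
       (c * (of_nat N * z ^ (N - 1)) * poly a z ^ 2 - c * z ^ N * (2 * poly a z * poly (pderiv a) z))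
         / (poly a z ^ 2 * poly a z ^ 2)" by (rule DERIV_imp_deriv)
    have "z * deriv g z = g z * (of_nat N - 2 * (z * poly (pderiv a) z / poly a z))"
      unfolding dg g_def using az z0' \<open>0 < N\<close>
      by (cases N) (simp_all add: field_simps power2_eq_square)
    then have "Re (z * deriv g z) = u * (real N - 2 * Re (z * poly (pderiv a) z / poly a z))"
      using u by (simp flip: times_divide_eq_right mult.assoc)
    moreover have "2 * Re (z * poly (pderiv a) z / poly a z) < real N"
      using zf zR by (intro Re_log_deriv_zero_free_disc assms) auto
    ultimately have "0 < Re (z * deriv g z)" using u1 by simp
    from local_decrease_norm[OF hol U u(1) this u1] obtain w s' where
      w: "norm w < norm z" "g w = of_real s'" "1 < s'" "s' < u" by blast
    then have "w \<in> K" using zR u by (auto simp: K_def)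
    then show False using z(2) w(1) by force
  qed
  \<comment> \<open>By \<open>ne\<close> the value 1 is not taken inside the open disc, so
    \<open>z1\<close> lies on the boundary. Then \<open>z0\<close> is a point of smallest modulus
    too, with value \<open>s > 1\<close>, and \<open>step\<close> applies to it.\<close>
  have "g z1 = 1" using step z1 by blast
  then have "\<not> norm z1 < R" using ne[of z1] by (auto simp: g_def divide_simps split: if_splits)
  then have "norm z0 = norm z1" using z1(2)[OF z0K] z0 z1(1) by (auto simp: K_def)
  moreover have "g z0 \<noteq> 1" using eq zf[OF z0] \<open>1 < s\<close> by (auto simp: g_def)
  ultimately show False using step z1 z0K by metis
qed

subsection \<open>Even-length continued fractions\<close>

definition expansion :: "nat list \<Rightarrow> bool" where
  "expansion as \<longleftrightarrow> as \<noteq> [] \<and> even (length as) \<and> (\<forall>a\<in>set as. a \<ge> 1)"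

lemma expansion_pair [simp]: "expansion [a, b] \<longleftrightarrow> a \<ge> 1 \<and> b \<ge> 1"
  by (auto simp: expansion_def)

lemma expansion_pair_append:
  "expansion as \<Longrightarrow> expansion (a # b # as) \<longleftrightarrow> a \<ge> 1 \<and> b \<ge> 1"
  by (auto simp: expansion_def)

lemma expansion_cases [consumes 1, case_names pair append]:
  assumes "expansion as"
  obtains a b where "a \<ge> 1" "b \<ge> 1" "as = [a, b]"
  | a b bs where "a \<ge> 1" "b \<ge> 1" "expansion bs" "as = a # b # bs"
proof -
  obtain a b bs where as: "as = a # b # bs"
    using assms
    by (metis expansion_def One_nat_def even_Suc length_0_conv length_Suc_conv list.exhaust odd_one)
  then have "a \<ge> 1" "b \<ge> 1" "bs = [] \<or> expansion bs" using assms by (auto simp: expansion_def)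
  then show thesis using as that by blast
qed

lemma expansion_induct [consumes 1, case_names pair append]:
  assumes "expansion as"
    and "\<And>a b. a \<ge> 1 \<Longrightarrow> b \<ge> 1 \<Longrightarrow> P [a, b]"
    and "\<And>a b as. a \<ge> 1 \<Longrightarrow> b \<ge> 1 \<Longrightarrow> expansion as \<Longrightarrow> P as \<Longrightarrow> P (a # b # as)"
  shows "P as"
  using assms(1)
proof (induction as rule: length_induct)
  case (1 as)
  from 1(2) show ?case
  proof (cases rule: expansion_cases)
    case (append a b bs)
    then show ?thesis using 1(1) assms(3) by simp
  qed (use assms(2) in simp)
qed

lemma cfrac_pair [simp]: "cfrac [a, b] = of_nat a + 1 / of_nat b"
  by simp

lemma cfrac_pair_append:
  "expansion as \<Longrightarrow> cfrac (a # b # as) = of_nat a + 1 / (of_nat b + 1 / cfrac as)"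
  by (cases as) (auto simp: expansion_def)

lemma cfrac_gt_1: "expansion as \<Longrightarrow> cfrac as > 1"
proof (induction rule: expansion_induct)
  case (pair a b)
  then have "1 / (of_nat b :: rat) > 0" "(of_nat a :: rat) \<ge> 1" by simp_all
  then show ?case unfolding cfrac_pair by linarith
next
  case (append a b as)
  then have "(of_nat b :: rat) + 1 / cfrac as > 0" by (simp add: add_pos_pos)
  then have "1 / (of_nat b + 1 / cfrac as) > 0" "(of_nat a :: rat) \<ge> 1" using append by simp_all
  then show ?case unfolding cfrac_pair_append[OF append(3)] by linarith
qed

lemma of_nat_add_eqD:
  fixes t t' :: "'a :: linordered_idom"
  assumes "of_nat a + t = of_nat a' + t'" "\<bar>t - t'\<bar> < 1"
  shows "a = a'" "t = t'"
proof -
  have "(of_nat a :: 'a) < of_nat (a' + 1)" "(of_nat a' :: 'a) < of_nat (a + 1)"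
    using assms by (simp_all add: algebra_simps abs_less_iff)
  then show "a = a'" by (simp only: of_nat_less_iff)
  then show "t = t'" using assms by simp
qed

text \<open>The two coefficients of a pair are determined by rounding up the fraction and rounding down
  the reciprocal of its remainder; a vanishing second remainder \<open>s\<close> marks the end.\<close>

lemma expansion_remainders:
  assumes "expansion as"
  obtains a b s bs where "as = a # b # bs" "0 \<le> s" "s < 1"
    "cfrac as = of_nat a + 1 / (of_nat b + s)" "0 < 1 / (of_nat b + s)" "1 / (of_nat b + s) \<le> 1"
    "bs = [] \<and> s = 0 \<or> expansion bs \<and> s = 1 / cfrac bs \<and> s \<noteq> 0"
  using assms
proof (cases rule: expansion_cases)
  case (pair a b)
  then show thesis by (intro that[of a b "[]" 0]) simp_all
next
  case (append a b bs)
  have s: "0 < 1 / cfrac bs" "1 / cfrac bs < 1" using cfrac_gt_1[OF append(3)] by simp_all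
  have "(of_nat b :: rat) \<ge> 1" using append by simp
  then have "of_nat b + 1 / cfrac bs \<ge> 1" using s by linarith
  then have "0 < 1 / (of_nat b + 1 / cfrac bs)" "1 / (of_nat b + 1 / cfrac bs) \<le> 1"
    by (simp_all add: divide_le_eq_1)
  then show ?thesis
    using append s cfrac_pair_append[OF append(3), of a b]
    by (intro that[of a b bs "1 / cfrac bs"]) (assumption | simp del: cfrac.simps; fail)+
qed

lemma cfrac_inject:
  assumes "expansion as" "expansion bs" "cfrac as = cfrac bs"
  shows "as = bs"
  using assms
proof (induction as arbitrary: bs rule: length_induct)
  case (1 as)
  obtain a b s cs where as: "as = a # b # cs" "0 \<le> s" "s < 1"
    "cfrac as = of_nat a + 1 / (of_nat b + s)" "0 < 1 / (of_nat b + s)" "1 / (of_nat b + s) \<le> 1"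
    "cs = [] \<and> s = 0 \<or> expansion cs \<and> s = 1 / cfrac cs \<and> s \<noteq> 0"
    by (rule expansion_remainders[OF 1(2)])
  obtain a' b' s' cs' where bs: "bs = a' # b' # cs'" "0 \<le> s'" "s' < 1"
    "cfrac bs = of_nat a' + 1 / (of_nat b' + s')" "0 < 1 / (of_nat b' + s')"
    "1 / (of_nat b' + s') \<le> 1"
    "cs' = [] \<and> s' = 0 \<or> expansion cs' \<and> s' = 1 / cfrac cs' \<and> s' \<noteq> 0"
    by (rule expansion_remainders[OF 1(3)])
  have eq: "of_nat a + 1 / (of_nat b + s) = of_nat a' + 1 / (of_nat b' + s')"
    using as(4) bs(4) 1(4) by simp
  have "\<bar>1 / (of_nat b + s) - 1 / (of_nat b' + s')\<bar> < 1" using as(5,6) bs(5,6) by linarith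
  note a = of_nat_add_eqD[OF eq this]
  then have "of_nat b + s = of_nat b' + s'" by (simp only: divide_cancel_left) simp
  moreover have "\<bar>s - s'\<bar> < 1" using as(2,3) bs(2,3) by linarith
  ultimately have b: "b = b'" "s = s'" using of_nat_add_eqD by blast+
  then have "cs = [] \<and> cs' = [] \<or> expansion cs \<and> expansion cs' \<and> cfrac cs = cfrac cs'"
    using as(7) bs(7) by auto
  then have "cs = cs'" using 1(1) as(1) by auto
  then show ?case using as(1) bs(1) a b by simp
qed

text \<open>Euclid's algorithm with two divisions per round, by induction on the
  denominator.\<close>

lemma expansion_exists:
  assumes "x > 1"
  shows "\<exists>as. expansion as \<and> cfrac as = x"
proof -
  have "\<exists>as. expansion as \<and> cfrac as = of_nat r / of_nat s" if "0 < s" "s < r" for r s :: nat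
    using that
  proof (induction s arbitrary: r rule: less_induct)
    case (less s)
    \<comment> \<open>Dividing \<open>r - 1\<close> makes the remainder \<open>u\<close> range over
      1 to \<open>s\<close> instead of 0 to \<open>s - 1\<close>. The algorithm can therefore stop
      only after the second division, which yields even length.\<close>
    define a where "a = (r - 1) div s"
    define u where "u = (r - 1) mod s + 1"
    have r: "r = a * s + u" using less(2,3) by (simp add: a_def u_def)
    have "a \<ge> 1" unfolding a_def using less(2,3) by (simp add: Suc_leI div_greater_zero_iff)
    have "u \<ge> 1" "u \<le> s" using less(2) by (auto simp: u_def Suc_leI)
    define b where "b = s div u"
    define v where "v = s mod u"
    have s: "s = b * u + v" by (simp add: b_def v_def)
    have "b \<ge> 1" unfolding b_def using \<open>u \<ge> 1\<close> \<open>u \<le> s\<close> by (simp add: Suc_leI div_greater_zero_iff)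
    have "v < u" using \<open>u \<ge> 1\<close> by (simp add: v_def)
    have x: "(of_nat r / of_nat s :: rat) = of_nat a + of_nat u / of_nat s"
      using less(2) by (simp add: r field_simps)
    show ?case
    proof (cases "v = 0")
      case True
      then have "cfrac [a, b] = of_nat r / of_nat s"
        using x s \<open>u \<ge> 1\<close> \<open>b \<ge> 1\<close> by (simp add: field_simps)
      then show ?thesis using \<open>a \<ge> 1\<close> \<open>b \<ge> 1\<close> by (intro exI[of _ "[a, b]"]) simp
    next
      case False
      then obtain as where as: "expansion as" "cfrac as = of_nat u / of_nat v"
        using less.IH[of v u] \<open>v < u\<close> \<open>u \<le> s\<close> by auto
      have "cfrac (a # b # as) = of_nat a + 1 / (of_nat b + of_nat v / of_nat u)"
        using as by (simp add: cfrac_pair_append del: cfrac.simps)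
      also have "of_nat b + of_nat v / of_nat u = (of_nat s / of_nat u :: rat)"
        using \<open>u \<ge> 1\<close> s by (simp add: field_simps flip: of_nat_mult of_nat_add)
      finally have "cfrac (a # b # as) = of_nat r / of_nat s" using x by simp
      then show ?thesis
        using as(1) \<open>a \<ge> 1\<close> \<open>b \<ge> 1\<close> by (metis expansion_pair_append)
    qed
  qed
  moreover obtain r s where x: "x = of_int r / of_int s" "s > 0"
    by (metis quotient_of_div quotient_of_denom_pos surj_pair)
  have "s < r" using assms x by (simp add: field_simps)
  have "x = of_nat (nat r) / of_nat (nat s)" using x \<open>s < r\<close> by (simp add: of_nat_nat)
  ultimately show ?thesis using x \<open>s < r\<close> by (metis nat_mono_iff order.strict_trans zero_less_nat_eq)
qed

lemma even_expansion_cfrac: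
  assumes "expansion as"
  shows "even_expansion (cfrac as) = as"
  unfolding even_expansion_def
proof (rule the_equality)
  show "as \<noteq> [] \<and> even (length as) \<and> (\<forall>a\<in>set as. a \<ge> 1) \<and> cfrac as = cfrac as"
    using assms by (simp add: expansion_def)
next
  fix bs assume "bs \<noteq> [] \<and> even (length bs) \<and> (\<forall>a\<in>set bs. a \<ge> 1) \<and> cfrac bs = cfrac as"
  then show "bs = as" using assms cfrac_inject[of bs as] by (simp add: expansion_def)
qed

subsection \<open>The q-deformation as a power series\<close>

lemma q_int_Suc: "q_int q (Suc n) = q_int q n + q ^ n"
  by (simp add: q_int_def)

lemma q_int_0 [simp]: "q_int q 0 = 0"
  by (simp add: q_int_def)

lemma q_int_Suc': "q_int q (Suc n) = 1 + q * q_int q n"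
  unfolding q_int_def sum.lessThan_Suc_shift by (simp add: sum_distrib_left)

lemma q_int_geometric: "(q - 1) * q_int q n = q ^ n - 1"
  by (simp add: q_int_def power_diff_1_eq)

lemma q_int_inverse:
  assumes "q \<noteq> 0"
  shows "q_int (inverse q) n = q * q_int q n / q ^ n"
proof -
  have "q_int (inverse q) n * q ^ n = q * q_int q n"
  proof (induction n)
    case (Suc n)
    have "inverse q ^ n * q ^ n = 1" using assms by (simp flip: power_mult_distrib)
    then have "q_int (inverse q) (Suc n) * q ^ Suc n = q * (q_int (inverse q) n * q ^ n) + q"
      by (simp add: q_int_Suc algebra_simps)
    also have "\<dots> = q * q_int q (Suc n)" unfolding Suc by (simp add: q_int_Suc' algebra_simps)
    finally show ?case .
  qed simp
  then show ?thesis using assms by (simp add: eq_divide_eq)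
qed

text \<open>A polynomial can be read both as a Taylor series, through \<open>fps_of_poly\<close>,
  and as a function on the complex plane, through \<open>poly\<close>.\<close>

definition q_int_poly :: "nat \<Rightarrow> complex poly" where
  "q_int_poly n = (\<Sum>i<n. monom 1 i)"

abbreviation q_int_fps :: "nat \<Rightarrow> complex fps" where
  "q_int_fps n \<equiv> fps_of_poly (q_int_poly n)"

lemma poly_q_int_poly [simp]: "poly (q_int_poly n) z = q_int z n"
  by (simp add: q_int_poly_def q_int_def poly_sum poly_monom)

lemma q_int_fls_X: "q_int fls_X n = fps_to_fls (q_int_fps n)"
proof -
  have "fps_to_fls (\<Sum>i<n. fps_X ^ i) = (\<Sum>i<n. fls_X ^ i :: complex fls)" for n
    by (induction n) (simp_all add: fps_to_fls_power)
  then show ?thesis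
    by (simp add: q_int_def q_int_poly_def fps_of_poly_sum fps_of_poly_monom')
qed

lemma coeff_q_int_poly_0: "n \<ge> 1 \<Longrightarrow> coeff (q_int_poly n) 0 = 1"
  using poly_q_int_poly[of n 0] by (cases n) (simp_all add: q_int_Suc' poly_0_coeff_0 del: poly_q_int_poly)

text \<open>Two levels of the fraction, cleared of negative powers of \<open>q\<close> by
  \<open>q_int (inverse q) b = q * q_int q b / q ^ b\<close>. The inverted series has constant term
  1, so no Laurent series are involved.\<close>

definition q_step :: "nat \<Rightarrow> nat \<Rightarrow> complex fps \<Rightarrow> complex fps" where
  "q_step a b Y = q_int_fps a + fps_X ^ (a + b) * Y * inverse (1 + fps_X * q_int_fps b * Y)"

fun q_fps :: "nat list \<Rightarrow> complex fps" where
  "q_fps [a, b] = q_int_fps a + fps_X ^ (a + b - 1) * inverse (q_int_fps b)"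
| "q_fps (a # b # as) = q_step a b (q_fps as)"
| "q_fps _ = 0"

lemma q_fps_append: "expansion as \<Longrightarrow> q_fps (a # b # as) = q_step a b (q_fps as)"
  by (cases as) (auto simp: expansion_def)

lemma fps_nth_q_step_0: "a \<ge> 1 \<Longrightarrow> fps_nth (q_step a b Y) 0 = 1"
  by (simp add: q_step_def coeff_q_int_poly_0)

lemma q_cfrac_pair:
  assumes "q \<noteq> 0" "b \<ge> 1"
  shows "q_cfrac q [a, b] = q_int q a + q ^ (a + b - 1) * inverse (q_int q b)"
  using assms by (cases b) (simp_all add: q_int_inverse power_add divide_inverse)

lemma q_cfrac_append:
  assumes "expansion as" "q \<noteq> 0" "q_cfrac q as \<noteq> 0" "1 + q * q_int q b * q_cfrac q as \<noteq> 0"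
  shows "q_cfrac q (a # b # as) =
    q_int q a + q ^ (a + b) * q_cfrac q as * inverse (1 + q * q_int q b * q_cfrac q as)"
proof -
  have "q_int (inverse q) b + inverse q ^ b / q_cfrac q as
      = (1 + q * q_int q b * q_cfrac q as) / (q ^ b * q_cfrac q as)"
    unfolding q_int_inverse[OF assms(2)] power_inverse using assms(2,3)
    by (simp add: field_simps)
  moreover have "q_cfrac q (a # b # as) =
      q_int q a + q ^ a / (q_int (inverse q) b + inverse q ^ b / q_cfrac q as)"
    using assms(1) by (cases as) (auto simp: expansion_def)
  ultimately show ?thesis by (simp add: power_add divide_inverse ac_simps)
qed

lemma inverse_fps_to_fls:
  fixes f :: "'a :: field fps"
  shows "fps_nth f 0 \<noteq> 0 \<Longrightarrow> inverse (fps_to_fls f) = fps_to_fls (inverse f)"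
  by (rule fls_inverse_fps_to_fls) (simp add: subdegree_eq_0)

text \<open>Negative powers of \<open>q\<close> cancel within each pair of levels. The constant term
  1 strengthens the induction: the next pair divides by this series.\<close>

lemma q_cfrac_fls_X:
  "expansion as \<Longrightarrow> q_cfrac fls_X as = fps_to_fls (q_fps as) \<and> fps_nth (q_fps as) 0 = 1"
proof (induction rule: expansion_induct)
  case (pair a b)
  let ?q = "fls_X :: complex fls"
  obtain b' where b: "b = Suc b'" using pair by (cases b) auto
  have "q_cfrac ?q [a, b] = q_int ?q a + ?q ^ (a + b') * inverse (q_int ?q b)"
    using q_cfrac_pair[of ?q b a] by (simp add: b)
  also have "inverse (q_int ?q b) = fps_to_fls (inverse (q_int_fps b))"
    unfolding q_int_fls_X using pair coeff_q_int_poly_0[of b] by (intro inverse_fps_to_fls) simp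
  finally have "q_cfrac ?q [a, b] = fps_to_fls (q_fps [a, b])"
    by (simp add: b q_int_fls_X fls_times_fps_to_fls fps_to_fls_power)
  moreover have "fps_nth (q_fps [a, b]) 0 = 1"
    using pair by (simp add: coeff_q_int_poly_0)
  ultimately show ?case by simp
next
  case (append a b as)
  let ?q = "fls_X :: complex fls" and ?Y = "fps_to_fls (q_fps as)"
  have Y: "?Y \<noteq> 0" using append.IH by auto
  have den: "1 + ?q * q_int ?q b * ?Y = fps_to_fls (1 + fps_X * q_int_fps b * q_fps as)"
    by (simp add: q_int_fls_X fls_times_fps_to_fls)
  have nz: "1 + ?q * q_int ?q b * ?Y \<noteq> 0"
  proof -
    have "fps_nth (1 + fps_X * q_int_fps b * q_fps as) 0 \<noteq> 0" by simp
    then have "1 + fps_X * q_int_fps b * q_fps as \<noteq> 0" by (metis fps_zero_nth)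
    then show ?thesis unfolding den fps_to_fls_eq_0_iff .
  qed
  have "q_cfrac ?q (a # b # as)
      = q_int ?q a + ?q ^ (a + b) * ?Y * inverse (1 + ?q * q_int ?q b * ?Y)"
    using q_cfrac_append[of as ?q b a] append Y nz by simp
  also have "inverse (1 + ?q * q_int ?q b * ?Y)
      = fps_to_fls (inverse (1 + fps_X * q_int_fps b * q_fps as))"
    unfolding den by (intro inverse_fps_to_fls) simp
  finally have "q_cfrac ?q (a # b # as) = fps_to_fls (q_fps (a # b # as))"
    using append by (simp add: q_fps_append q_step_def q_int_fls_X 
        fls_times_fps_to_fls fps_to_fls_power)
  then show ?case using append by (simp add: q_fps_append fps_nth_q_step_0)
qed

lemma q_rational_cfrac:
  assumes "expansion as"
  shows "q_rational (cfrac as) = q_fps as"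
  using q_cfrac_fls_X[OF assms] by (simp add: q_rational_def even_expansion_cfrac[OF assms])

subsection \<open>The series of the metallic numbers\<close>

text \<open>From \<open>x (x - n) = 1\<close> for the metallic number \<open>x\<close>: stripping
  one period from its continued fraction gives \<open>x\<close> back.\<close>

lemma metallic_gt: "n \<ge> 1 \<Longrightarrow> metallic n > real n"
  and metallic_fixed: "n \<ge> 1 \<Longrightarrow> 1 / (1 / (metallic n - real n) - real n) = metallic n"
proof -
  assume n: "n \<ge> 1"
  let ?s = "sqrt (real n ^ 2 + 4)"
  have "sqrt (real n ^ 2) < ?s" by (rule real_sqrt_less_mono) simp
  then have s: "real n < ?s" by simp
  then show "metallic n > real n" by (simp add: metallic_def)
  have "?s * ?s = real n ^ 2 + 4" by simp
  then have "metallic n * (metallic n - real n) = 1"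
    by (simp add: metallic_def field_simps power2_eq_square)
  then have "1 / (metallic n - real n) = metallic n"
    by (metis divide_eq_eq mult_zero_right zero_neq_one)
  then show "1 / (1 / (metallic n - real n) - real n) = metallic n" by simp
qed

lemma expansion_replicate_append:
  "n \<ge> 1 \<Longrightarrow> expansion as \<Longrightarrow> expansion (replicate (2 * j) n @ as)"
  by (auto simp: expansion_def)

lemma q_fps_replicate_append:
  assumes "n \<ge> 1" "expansion as"
  shows "q_fps (replicate (2 * j) n @ as) = (q_step n n ^^ j) (q_fps as)"
  using assms by (induction j) (simp_all add: q_fps_append expansion_replicate_append)

text \<open>Stripping a period is continuous at the metallic number and fixes it, so the stripped
  sequence \<open>Y\<close> has the same limit and supplies the remaining periods by
  induction.\<close>

lemma eventually_expansion_metallic: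
  fixes X :: "nat \<Rightarrow> rat"
  assumes n: "n \<ge> 1" and "(\<lambda>k. of_rat (X k)) \<longlonglongrightarrow> metallic n"
  shows "\<forall>\<^sub>F k in sequentially. \<exists>as. expansion as \<and> X k = cfrac (replicate (2 * j) n @ as)"
  using assms(2)
proof (induction j arbitrary: X)
  case 0
  have "metallic n > 1" using metallic_gt[OF n] n by linarith
  then have "\<forall>\<^sub>F k in sequentially. of_rat (X k) > (1 :: real)"
    by (rule order_tendstoD(1)[OF 0])
  then show ?case by eventually_elim (use expansion_exists in force)
next
  case (Suc j)
  define Y where "Y k = 1 / (1 / (X k - of_nat n) - of_nat n)" for k
  have m: "metallic n - real n \<noteq> 0" using metallic_gt[OF n] by simp
  have m': "1 / (metallic n - real n) - real n \<noteq> 0"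
    using metallic_fixed[OF n] metallic_gt[OF n] by (metis div_by_0 not_less of_nat_0_le_iff)
  have "(\<lambda>k. 1 / (1 / (of_rat (X k) - real n) - real n)) \<longlonglongrightarrow> 1 / (1 / (metallic n - real n) - real n)"
    using m m' by (intro tendsto_intros Suc.prems)
  then have "(\<lambda>k. of_rat (Y k)) \<longlonglongrightarrow> metallic n"
    by (simp add: Y_def metallic_fixed[OF n] of_rat_divide of_rat_diff)
  from Suc.IH[OF this]
  have "\<forall>\<^sub>F k in sequentially. \<exists>as. expansion as \<and> Y k = cfrac (replicate (2 * j) n @ as)" .
  then show ?case
  proof eventually_elim
    case (elim k)
    then obtain as where as: "expansion as" "Y k = cfrac (replicate (2 * j) n @ as)" by blast
    let ?bs = "replicate (2 * j) n @ as"
    have bs: "expansion ?bs" using n as by (simp add: expansion_replicate_append)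
    then have "Y k > 1" using as cfrac_gt_1 by metis
    \<comment> \<open>Division by zero gives 0, so \<open>Y k > 1\<close> excludes a vanishing
      denominator.\<close>
    then have "1 / (X k - of_nat n) - of_nat n \<noteq> 0" by (auto simp: Y_def)
    then have y: "1 / (X k - of_nat n) = of_nat n + 1 / Y k" by (simp add: Y_def)
    then have "X k = of_nat n + 1 / (of_nat n + 1 / Y k)"
      by (metis add_diff_cancel_left' diff_add_cancel divide_divide_eq_right add.commute mult_1 div_by_1)
    also have "\<dots> = cfrac (n # n # ?bs)" using cfrac_pair_append[OF bs] as by simp
    finally show ?case using as(1) by (intro exI[of _ as]) simp
  qed
qed

text \<open>Two Taylor series that agree modulo \<open>q\<^sup>m\<close> have images agreeing modulo \<open>q\<^bsup>m+2n\<^esup>\<close>, because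
  the matrix of this Moebius map has determinant \<open>q\<^bsup>2n\<^esup>\<close>.\<close>

lemma q_step_diff:
  "q_step n n Y - q_step n n Z = fps_X ^ (2 * n) * (Y - Z) *
     (inverse (1 + fps_X * q_int_fps n * Y) * inverse (1 + fps_X * q_int_fps n * Z))"
proof -
  let ?u = "1 + fps_X * q_int_fps n * Y" and ?v = "1 + fps_X * q_int_fps n * Z"
  have u: "inverse ?u * ?u = 1" and v: "inverse ?v * ?v = 1"
    by (simp_all add: inverse_mult_eq_1)
  have "Y * inverse ?u - Z * inverse ?v = Y * inverse ?u * (inverse ?v * ?v) - Z * inverse ?v * (inverse ?u * ?u)"
    using u v by simp
  also have "\<dots> = (Y - Z) * (inverse ?u * inverse ?v)" by (simp add: algebra_simps)
  finally have "Y * inverse ?u - Z * inverse ?v = (Y - Z) * (inverse ?u * inverse ?v)" .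
  then have "fps_X ^ (2 * n) * (Y * inverse ?u - Z * inverse ?v)
      = fps_X ^ (2 * n) * ((Y - Z) * (inverse ?u * inverse ?v))" by simp
  then show ?thesis unfolding q_step_def mult_2 by (simp only: algebra_simps)
qed

lemma fps_X_power_dvd_iff:
  fixes f :: "'a :: field fps"
  shows "fps_X ^ m dvd f \<longleftrightarrow> (\<forall>s<m. fps_nth f s = 0)"
proof
  assume "\<forall>s<m. fps_nth f s = 0"
  then have "f = 0 \<or> m \<le> subdegree f" by (metis subdegree_geI)
  then show "fps_X ^ m dvd f" by (cases "f = 0") (simp_all add: fps_dvd_iff)
qed (auto simp: fps_X_power_mult_nth)

lemma q_step_iterate_nth:
  assumes "s < 2 * n * j"
  shows "fps_nth ((q_step n n ^^ j) Y) s = fps_nth ((q_step n n ^^ j) Z) s"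
proof -
  have "fps_X ^ (2 * n * j) dvd (q_step n n ^^ j) Y - (q_step n n ^^ j) Z"
  proof (induction j)
    case (Suc j)
    then show ?case
      unfolding funpow.simps o_apply q_step_diff mult_Suc_right power_add
      by (intro dvd_mult2 mult_dvd_mono dvd_refl)
  qed simp
  then show ?thesis using assms by (simp add: fps_X_power_dvd_iff)
qed

text \<open>By \<open>q_step_iterate_nth\<close>, \<open>j\<close> periods settle all coefficients
  below \<open>2 * n * j\<close>; for positive \<open>n\<close>, \<open>s + 1\<close> periods from
  any start settle coefficient \<open>s\<close>.\<close>

definition metallic_fps :: "nat \<Rightarrow> complex fps" where
  "metallic_fps n = Abs_fps (\<lambda>s. fps_nth ((q_step n n ^^ Suc s) 0) s)"

lemma metallic_fps_nth:
  assumes "n \<ge> 1" "s < j"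
  shows "fps_nth ((q_step n n ^^ j) Y) s = fps_nth (metallic_fps n) s"
proof -
  have "j = Suc s + (j - Suc s)" using assms by simp
  then have "(q_step n n ^^ j) Y = (q_step n n ^^ Suc s) ((q_step n n ^^ (j - Suc s)) Y)"
    by (metis funpow_add o_apply)
  moreover have "s < 2 * n * Suc s" using assms by (cases n) auto
  ultimately show ?thesis
    unfolding metallic_fps_def fps_nth_Abs_fps using q_step_iterate_nth by metis
qed

lemma q_step_metallic_fps:
  assumes "n \<ge> 1"
  shows "q_step n n (metallic_fps n) = metallic_fps n"
proof (rule fps_ext)
  fix s
  define Z where "Z = (q_step n n ^^ Suc s) 0"
  have "fps_X ^ Suc s dvd metallic_fps n - Z"
    using metallic_fps_nth[OF assms, of _ "Suc s" 0]
    by (simp add: Z_def fps_X_power_dvd_iff del: power_Suc funpow.simps)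
  then have "fps_X ^ Suc s dvd q_step n n (metallic_fps n) - q_step n n Z"
    unfolding q_step_diff by (intro dvd_mult2 dvd_mult)
  then have "fps_nth (q_step n n (metallic_fps n)) s = fps_nth (q_step n n Z) s"
    by (simp add: fps_X_power_dvd_iff del: power_Suc)
  also have "q_step n n Z = (q_step n n ^^ Suc (Suc s)) 0" by (simp add: Z_def)
  also have "fps_nth \<dots> s = fps_nth (metallic_fps n) s"
    by (intro metallic_fps_nth assms) simp
  finally show "fps_nth (q_step n n (metallic_fps n)) s = fps_nth (metallic_fps n) s" .
qed

lemma q_irrational_metallic:
  assumes n: "n \<ge> 1"
  shows "q_irrational (metallic n) = metallic_fps n"
proof (rule fps_ext)
  fix s
  let ?P = "\<lambda>c. \<forall>X :: nat \<Rightarrow> rat. (\<lambda>k. of_rat (X k)) \<longlonglongrightarrow> metallic n \<longrightarrow>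
     (\<forall>\<^sub>F k in sequentially. fps_nth (q_rational (X k)) s = c)"
  have ex: "?P (fps_nth (metallic_fps n) s)"
  proof (intro allI impI)
    fix X :: "nat \<Rightarrow> rat" assume "(\<lambda>k. of_rat (X k)) \<longlonglongrightarrow> metallic n"
    from eventually_expansion_metallic[OF n this, of "Suc s"]
    show "\<forall>\<^sub>F k in sequentially. fps_nth (q_rational (X k)) s = fps_nth (metallic_fps n) s"
    proof eventually_elim
      case (elim k)
      then obtain as where as: "expansion as" "X k = cfrac (replicate (2 * Suc s) n @ as)" by blast
      then have "q_rational (X k) = (q_step n n ^^ Suc s) (q_fps as)"
        using n by (simp only: q_rational_cfrac expansion_replicate_append q_fps_replicate_append)
      then show ?case using metallic_fps_nth[OF n, of s "Suc s"] by simp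
    qed
  qed
  \<comment> \<open>Uniqueness for \<open>THE\<close> needs one actual sequence of rationals with
    this limit; without it the condition on \<open>c\<close> would be vacuous.\<close>
  have "\<exists>r. metallic n < of_rat r \<and> of_rat r < metallic n + 1 / real (Suc k)" for k
    using of_rat_dense[of "metallic n" "metallic n + 1 / real (Suc k)"] by simp
  then obtain X where X: "\<And>k. metallic n < of_rat (X k)" "\<And>k. of_rat (X k) < metallic n + 1 / real (Suc k)"
    by metis
  have lim: "(\<lambda>k. of_rat (X k)) \<longlonglongrightarrow> metallic n"
  proof (rule tendsto_sandwich[OF _ _ tendsto_const])
    have "(\<lambda>k. metallic n + 1 / real (Suc k)) \<longlonglongrightarrow> metallic n + 0"
      by (intro tendsto_intros LIMSEQ_Suc lim_1_over_n)
    then show "(\<lambda>k. metallic n + 1 / real (Suc k)) \<longlonglongrightarrow> metallic n" by simp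
    show "\<forall>\<^sub>F k in sequentially. metallic n \<le> of_rat (X k)"
      by (intro always_eventually allI less_imp_le X(1))
    show "\<forall>\<^sub>F k in sequentially. of_rat (X k) \<le> metallic n + 1 / real (Suc k)"
      by (intro always_eventually allI less_imp_le X(2))
  qed
  have "c = fps_nth (metallic_fps n) s" if c: "?P c" for c
  proof -
    have "\<forall>\<^sub>F k in sequentially. c = fps_nth (metallic_fps n) s"
      using c[rule_format, OF lim] ex[rule_format, OF lim] by eventually_elim simp
    then show ?thesis by simp
  qed
  then have "(THE c. ?P c) = fps_nth (metallic_fps n) s" using ex by (intro the_equality)
  then show "fps_nth (q_irrational (metallic n)) s = fps_nth (metallic_fps n) s"
    by (simp add: q_irrational_def)
qed

text \<open>With \<open>y = q ^ n\<close> and \<open>h = [n]\<close>, clearing the denominator of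
  the fixed point equation leaves the known quadratic equation times a factor \<open>h\<close>, to
  be cancelled later.\<close>

lemma fixed_point_quadratic:
  fixes q h y M :: "'a :: idom"
  assumes "M * (1 + q * h * M) = h * (1 + q * h * M) + y * y * M" "(q - 1) * h = y - 1"
  shows "h * (q * M ^ 2 - ((q - 1) * (y + 1) + q * h) * M - 1) = 0"
proof -
  have "h * (q * M ^ 2 - ((q - 1) * (y + 1) + q * h) * M - 1)
      = M * (1 + q * h * M) - h * (1 + q * h * M) - M - (q - 1) * h * ((y + 1) * M)"
    by (simp add: algebra_simps power2_eq_square)
  also have "\<dots> = 0" unfolding assms by (simp add: algebra_simps)
  finally show ?thesis .
qed

lemma metallic_fps_quadratic:
  assumes n: "n \<ge> 1"
  defines "h \<equiv> q_int_fps n"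
  defines "b \<equiv> (fps_X - 1) * (fps_X ^ n + 1) + fps_X * h"
  shows "fps_X * metallic_fps n ^ 2 - b * metallic_fps n - 1 = 0"
proof -
  let ?M = "metallic_fps n" and ?X = "fps_X :: complex fps"
  define u where "u = 1 + ?X * h * ?M"
  have "h + ?X ^ (n + n) * ?M * inverse u = ?M"
    using q_step_metallic_fps[OF n] unfolding q_step_def h_def u_def .
  then have "?M * u = (h + ?X ^ (n + n) * ?M * inverse u) * u" by simp
  also have "\<dots> = h * u + ?X ^ n * ?X ^ n * ?M * (inverse u * u)"
    by (simp only: algebra_simps power_add)
  also have "inverse u * u = 1" by (simp add: u_def inverse_mult_eq_1)
  finally have M: "?M * (1 + ?X * h * ?M) = h * (1 + ?X * h * ?M) + ?X ^ n * ?X ^ n * ?M"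
    by (simp only: u_def mult_1_right)
  have "poly ([:-1, 1:] * q_int_poly n) z = poly (monom 1 n - 1) z" for z
    using q_int_geometric[of z n] by (simp add: poly_monom algebra_simps)
  then have "[:-1, 1:] * q_int_poly n = monom 1 n - 1"
    by (rule poly_ext)
  then have "fps_of_poly ([:-1, 1:] * q_int_poly n) = fps_of_poly (monom 1 n - 1)" by simp
  then have "(?X - 1) * h = ?X ^ n - 1"
    by (simp add: fps_of_poly_mult fps_of_poly_diff fps_of_poly_monom' fps_of_poly_pCons h_def)
  then have "h * (?X * ?M ^ 2 - b * ?M - 1) = 0"
    using M unfolding b_def by (intro fixed_point_quadratic)
  moreover have "h \<noteq> 0"
    using coeff_q_int_poly_0[OF n] by (metis fps_of_poly_nth fps_zero_nth h_def zero_neq_one)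
  ultimately show ?thesis by simp
qed

subsection \<open>The Moebius map of one period\<close>

text \<open>If \<open>q Y\<^sup>2 - b Y - 1 = 0\<close> is the equation of the \<open>q\<close>-metallic number, then
  \<open>e = 2 q [n]\<^sub>q - b\<close> and the discriminant is \<open>b\<^sup>2 + 4 q\<close>; \<open>t\<close> is the trace of one period.\<close>

definition metallic_poly_e :: "nat \<Rightarrow> complex poly" where
  "metallic_poly_e n = [:0, 1:] * q_int_poly n - [:-1, 1:] * (monom 1 n + 1)"

definition metallic_poly_t :: "nat \<Rightarrow> complex poly" where
  "metallic_poly_t n = monom 1 (2 * n) + [:0, 1:] * q_int_poly n ^ 2 + 1"

definition metallic_discr :: "nat \<Rightarrow> complex poly" where
  "metallic_discr n = metallic_poly_e n ^ 2 + monom 4 (2 * n + 1)"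

lemma poly_metallic_poly_e:
  "poly (metallic_poly_e n) z = z * q_int z n - (z - 1) * (z ^ n + 1)"
  by (simp add: metallic_poly_e_def poly_monom algebra_simps)

lemma poly_metallic_poly_t:
  "poly (metallic_poly_t n) z = (z ^ n)\<^sup>2 + z * (q_int z n)\<^sup>2 + 1"
  by (simp add: metallic_poly_t_def poly_monom power_mult mult.commute)

lemma poly_metallic_discr:
  "poly (metallic_discr n) z = poly (metallic_poly_e n) z ^ 2 + 4 * z * (z ^ n)\<^sup>2"
  by (simp add: metallic_discr_def poly_monom power_mult mult.commute)

text \<open>The form \<open>e\<^sup>2 + 4 q ^ (2n+1)\<close> serves the starlikeness argument, the
  form \<open>b\<^sup>2 + 4 q\<close> the quadratic equation.\<close>

lemma poly_metallic_discr':
  "poly (metallic_discr n) z = ((z - 1) * (z ^ n + 1) + z * q_int z n)\<^sup>2 + 4 * z"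
proof -
  have "(z * h - (z - 1) * (y + 1))\<^sup>2 + 4 * z * y\<^sup>2 = ((z - 1) * (y + 1) + z * h)\<^sup>2 + 4 * z"
    if "(z - 1) * h = y - 1" for h y
    using that by algebra
  from this[OF q_int_geometric] show ?thesis
    unfolding poly_metallic_discr poly_metallic_poly_e .
qed

text \<open>The right side is trace squared minus four times the determinant, the discriminant of
  the characteristic polynomial of one period.\<close>

lemma metallic_discr_eq_t:
  "(q_int z n)\<^sup>2 * poly (metallic_discr n) z = poly (metallic_poly_t n) z ^ 2 - 4 * (z ^ n)\<^sup>2"
proof -
  have "h\<^sup>2 * ((z * h - (z - 1) * (y + 1))\<^sup>2 + 4 * z * y\<^sup>2) = (y\<^sup>2 + z * h\<^sup>2 + 1)\<^sup>2 - 4 * y\<^sup>2"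
    if "(z - 1) * h = y - 1" for h y
    using that by algebra
  from this[OF q_int_geometric] show ?thesis
    unfolding poly_metallic_discr poly_metallic_poly_e poly_metallic_poly_t .
qed

lemma metallic_poly_e_eq_t:
  "q_int z n * poly (metallic_poly_e n) z = poly (metallic_poly_t n) z - 2 * (z ^ n)\<^sup>2"
proof -
  have "h * (z * h - (z - 1) * (y + 1)) = (y\<^sup>2 + z * h\<^sup>2 + 1) - 2 * y\<^sup>2"
    if "(z - 1) * h = y - 1" for h y
    using that by algebra
  from this[OF q_int_geometric] show ?thesis
    unfolding poly_metallic_poly_e poly_metallic_poly_t .
qed

lemma degree_q_int_poly: "degree (q_int_poly n) \<le> n - 1"
  unfolding q_int_poly_def
  by (intro degree_sum_le order_trans[OF degree_monom_le]) auto

lemma degree_metallic_poly_e: "degree (metallic_poly_e n) \<le> n + 1"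
proof -
  have "degree ([:0, 1:] * q_int_poly n) \<le> n + 1"
    by (rule order_trans[OF degree_mult_le]) (use degree_q_int_poly[of n] in simp)
  moreover have "degree (monom 1 n + 1 :: complex poly) \<le> n"
    by (intro degree_add_le degree_monom_le) simp
  then have "degree ([:-1, 1:] * (monom 1 n + 1 :: complex poly)) \<le> n + 1"
    by (intro order_trans[OF degree_mult_le]) simp
  ultimately show ?thesis unfolding metallic_poly_e_def by (rule degree_diff_le)
qed

lemma degree_metallic_poly_t:
  assumes "n \<ge> 1"
  shows "degree (metallic_poly_t n) \<le> 2 * n"
proof -
  have "degree (q_int_poly n ^ 2) \<le> (n - 1) * 2"
    using degree_power_le[of "q_int_poly n" 2] degree_q_int_poly[of n] by (meson mult_le_mono1 order_trans)
  then have "degree ([:0, 1:] * q_int_poly n ^ 2) \<le> 2 * n"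
    using assms by (intro order_trans[OF degree_mult_le]) simp
  then show ?thesis
    unfolding metallic_poly_t_def by (intro degree_add_le degree_monom_le) simp_all
qed

text \<open>The matrix of one period, acting on pairs of a numerator and a denominator, with \<open>h = [n]\<^sub>q\<close>
  and \<open>c = q\<^bsup>2n\<^esup>\<close>.\<close>

definition moebius_step :: "'a::comm_ring_1 \<Rightarrow> 'a \<Rightarrow> 'a \<Rightarrow> 'a \<times> 'a \<Rightarrow> 'a \<times> 'a" where
  "moebius_step q h c v = (h * (snd v + q * h * fst v) + c * fst v, snd v + q * h * fst v)"

text \<open>A left eigenvector of the matrix of the Moebius map, for a square root \<open>w\<close> of the
  discriminant. It vanishes at one of the two fixed points.\<close>

definition fixed_point_form :: "nat \<Rightarrow> complex \<Rightarrow> complex \<Rightarrow> complex \<times> complex \<Rightarrow> complex" where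
  "fixed_point_form n z w v =
     2 * z * fst v - ((z - 1) * (z ^ n + 1) + z * q_int z n + w) * snd v"

lemma fixed_point_form_step:
  assumes "w\<^sup>2 = poly (metallic_discr n) z"
  shows "2 * fixed_point_form n z w (moebius_step z (q_int z n) ((z ^ n)\<^sup>2) v)
    = (poly (metallic_poly_t n) z - q_int z n * w) * fixed_point_form n z w v"
proof -
  have "2 * (2 * z * (h * (\<beta> + z * h * \<alpha>) + y\<^sup>2 * \<alpha>) - ((z - 1) * (y + 1) + z * h + w) * (\<beta> + z * h * \<alpha>))
      = (y\<^sup>2 + z * h\<^sup>2 + 1 - h * w) * (2 * z * \<alpha> - ((z - 1) * (y + 1) + z * h + w) * \<beta>)"
    if "(z - 1) * h = y - 1" "w\<^sup>2 = ((z - 1) * (y + 1) + z * h)\<^sup>2 + 4 * z" for h y \<alpha> \<beta>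
    using that by algebra
  from this[OF q_int_geometric assms[unfolded poly_metallic_discr']] show ?thesis
    unfolding poly_metallic_poly_t fixed_point_form_def moebius_step_def fst_conv snd_conv .
qed

lemma fixed_point_form_diff:
  "fixed_point_form n z (- w) v - fixed_point_form n z w v = 2 * w * snd v"
  by (simp add: fixed_point_form_def algebra_simps)

lemma norm_diff_less_norm_add:
  assumes "Re (w / e) > 0" "e \<noteq> 0"
  shows "norm (e - w) < norm (e + w)"
proof -
  define u where "u = w / e"
  have "(norm (1 - u))\<^sup>2 < (norm (1 + u))\<^sup>2"
    using assms(1) unfolding u_def cmod_power2 by (simp add: power2_eq_square algebra_simps)
  then have "norm (1 - u) < norm (1 + u)" by (rule power_less_imp_less_base) simp
  then have "norm e * norm (1 - u) < norm e * norm (1 + u)" using assms(2) by simp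
  then show ?thesis unfolding norm_mult[symmetric] using assms(2) by (simp add: u_def right_diff_distrib distrib_left)
qed

text \<open>Where the second component vanishes, the forms for \<open>w\<close> and
  \<open>-w\<close> agree. Each step multiplies them by the eigenvalues \<open>(t - h w) / 2\<close>
  and \<open>(t + h w) / 2\<close>, the first of smaller modulus, so their strict inequality
  persists.\<close>

lemma moebius_orbit_snd_nonzero:
  assumes w: "w\<^sup>2 = poly (metallic_discr n) z"
    and t: "poly (metallic_poly_t n) z \<noteq> 0" "Re (w * q_int z n / poly (metallic_poly_t n) z) > 0"
    and v: "norm (fixed_point_form n z w v) < norm (fixed_point_form n z (- w) v)"
  shows "snd ((moebius_step z (q_int z n) ((z ^ n)\<^sup>2) ^^ m) v) \<noteq> 0"
proof -
  let ?T = "poly (metallic_poly_t n) z" and ?h = "q_int z n"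
  let ?v = "\<lambda>m. (moebius_step z ?h ((z ^ n)\<^sup>2) ^^ m) v"
  have less: "norm (?T - ?h * w) < norm (?T + ?h * w)"
    using norm_diff_less_norm_add[OF t(2,1)] by (simp add: mult.commute)
  have "norm (fixed_point_form n z w (?v m)) < norm (fixed_point_form n z (- w) (?v m))"
  proof (induction m)
    case (Suc m)
    have "2 * norm (fixed_point_form n z w (?v (Suc m)))
        = norm (?T - ?h * w) * norm (fixed_point_form n z w (?v m))"
      using fixed_point_form_step[OF w, of "?v m", THEN arg_cong[of _ _ norm]] by (simp add: norm_mult)
    also have "\<dots> < norm (?T + ?h * w) * norm (fixed_point_form n z (- w) (?v m))"
      by (rule mult_strict_mono'[OF less Suc.IH]) simp_all
    also have "\<dots> = 2 * norm (fixed_point_form n z (- w) (?v (Suc m)))"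
      using fixed_point_form_step[of "- w" n z "?v m", THEN arg_cong[of _ _ norm]] w by (simp add: norm_mult)
    finally show ?case by simp
  qed (use v in simp)
  then show ?thesis using fixed_point_form_diff[of n z w "?v m"] by auto
qed

text \<open>For \<open>-w\<close> the value is \<open>e + w\<close>, so
  \<open>Re (w / e) > 0\<close> is what starts the orbit with the required inequality; the even
  start uses \<open>t\<close> and \<open>w h\<close> likewise.\<close>

lemma fixed_point_form_odd_start:
  "fixed_point_form n z w (q_int z n, 1) = poly (metallic_poly_e n) z - w"
  by (simp add: fixed_point_form_def poly_metallic_poly_e algebra_simps)

lemma fixed_point_form_even_start:
  assumes "n \<ge> 1"
  shows "fixed_point_form n z w ((q_int z n)\<^sup>2 + z ^ (2 * n - 1), q_int z n)
    = poly (metallic_poly_t n) z - w * q_int z n"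
proof -
  have "Suc (2 * n - 1) = n * 2" using assms by simp
  then have y: "z * z ^ (2 * n - 1) = (z ^ n)\<^sup>2" by (metis power_Suc power_mult)
  have "2 * z * (h\<^sup>2 + c) - ((z - 1) * (y + 1) + z * h + w) * h = y\<^sup>2 + z * h\<^sup>2 + 1 - w * h"
    if "(z - 1) * h = y - 1" "z * c = y\<^sup>2" for h y c
    using that by algebra
  from this[OF q_int_geometric y] show ?thesis
    unfolding fixed_point_form_def poly_metallic_poly_t fst_conv snd_conv .
qed

subsection \<open>Poles of the iterates\<close>

lemma q_int_nonzero:
  fixes z :: complex
  assumes "n \<ge> 1" "norm z < 1"
  shows "q_int z n \<noteq> 0"
proof
  assume "q_int z n = 0"
  then have "z ^ n = 1" using q_int_geometric[of z n] by simp
  then have "norm z ^ n = 1" by (metis norm_one norm_power)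
  then show False using assms power_less_one_iff[of "norm z" n] by simp
qed

text \<open>\<open>R\<close> is the smallest modulus of a zero of the discriminant, attained at
  \<open>z0\<close>. The zero-freeness of \<open>e\<close> and \<open>t\<close> up to that radius
  has to be checked for the particular \<open>n\<close>.\<close>

locale branch_radius =
  fixes n :: nat and R :: real and z0 :: complex
  assumes n: "n \<ge> 1" and R1: "R < 1"
    and e_nz: "\<And>z. norm z \<le> R \<Longrightarrow> poly (metallic_poly_e n) z \<noteq> 0"
    and t_nz: "\<And>z. norm z \<le> R \<Longrightarrow> poly (metallic_poly_t n) z \<noteq> 0"
    and discr_nz: "\<And>z. norm z < R \<Longrightarrow> poly (metallic_discr n) z \<noteq> 0"
    and z0: "norm z0 = R" "poly (metallic_discr n) z0 = 0"
begin

lemma poly_at_0: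
  "poly (metallic_discr n) 0 = 1" "poly (metallic_poly_e n) 0 = 1"
  "poly (metallic_poly_t n) 0 = 1" "q_int (0 :: complex) n = 1"
proof -
  obtain m where "n = Suc m" using n by (cases n) auto
  then show "poly (metallic_discr n) 0 = 1" "poly (metallic_poly_e n) 0 = 1"
    "poly (metallic_poly_t n) 0 = 1" "q_int (0 :: complex) n = 1"
    by (simp_all add: poly_metallic_discr poly_metallic_poly_e poly_metallic_poly_t q_int_Suc')
qed

lemma R_pos: "0 < R"
proof -
  have "z0 \<noteq> 0" using z0 poly_at_0(1) by auto
  then show ?thesis using z0 by auto
qed

lemma q_int_nz: "norm z \<le> R \<Longrightarrow> q_int (z :: complex) n \<noteq> 0"
  using q_int_nonzero n R1 by simp

section \<open>A branch of the square root with both real parts positive\<close>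

lemma e_avoids_ray:
  assumes "norm z \<le> R" "1 < s"
  shows "-4 * z ^ (2 * n + 1) \<noteq> of_real s * poly (metallic_poly_e n) z ^ 2"
proof (rule starlike_quotient_avoids_ray[OF _ _ e_nz _ assms])
  show "degree (metallic_poly_e n) \<le> 2 * n + 1" using degree_metallic_poly_e[of n] by simp
  show "-4 * z ^ (2 * n + 1) \<noteq> poly (metallic_poly_e n) z ^ 2" if "norm z < R" for z
    using discr_nz[OF that] by (auto simp: metallic_discr_def poly_monom eq_neg_iff_add_eq_0 add.commute
        dest: sym)
qed simp

lemma t_avoids_ray:
  assumes "norm z \<le> R" "1 < s"
  shows "4 * z ^ (2 * n) \<noteq> of_real s * poly (metallic_poly_t n) z ^ 2"
proof (rule starlike_quotient_avoids_ray[OF _ _ t_nz _ assms])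
  show "degree (metallic_poly_t n) \<le> 2 * n" by (rule degree_metallic_poly_t[OF n])
  show "4 * z ^ (2 * n) \<noteq> poly (metallic_poly_t n) z ^ 2" if "norm z < R" for z
  proof
    assume "4 * z ^ (2 * n) = poly (metallic_poly_t n) z ^ 2"
    then have "(q_int z n)\<^sup>2 * poly (metallic_discr n) z = 0"
      unfolding metallic_discr_eq_t by (simp add: power_mult mult.commute)
    then show False using discr_nz[OF that] q_int_nz[of z] that by simp
  qed
qed (use n in simp)

text \<open>Since \<open>D / e\<^sup>2 = 1 + 4 z ^ (2n+1) / e\<^sup>2\<close>, a value
  \<open>x < 0\<close> would put \<open>-4 z ^ (2n+1) / e\<^sup>2\<close> at
  \<open>1 - x > 1\<close>. Hence the principal root of \<open>D / e\<^sup>2\<close> is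
  continuous.\<close>

lemma branch_not_nonpos_e:
  assumes "norm z \<le> R" "poly (metallic_discr n) z \<noteq> 0"
  shows "poly (metallic_discr n) z / poly (metallic_poly_e n) z ^ 2 \<notin> \<real>\<^sub>\<le>\<^sub>0"
proof
  let ?e = "poly (metallic_poly_e n) z"
  assume "poly (metallic_discr n) z / ?e ^ 2 \<in> \<real>\<^sub>\<le>\<^sub>0"
  then obtain x where x: "x \<le> 0" "poly (metallic_discr n) z / ?e ^ 2 = of_real x"
    by (auto elim: nonpos_Reals_cases)
  then have D: "poly (metallic_discr n) z = of_real x * ?e ^ 2"
    using e_nz[OF assms(1)] by (simp add: divide_simps)
  then have "x \<noteq> 0" using assms(2) by auto
  moreover have "-4 * z ^ (2 * n + 1) = of_real (1 - x) * ?e ^ 2"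
    using D by (simp add: metallic_discr_def poly_monom algebra_simps)
  ultimately show False using e_avoids_ray[OF assms(1), of "1 - x"] x(1) by simp
qed

lemma branch_not_nonpos_t:
  assumes "norm z \<le> R" "poly (metallic_discr n) z \<noteq> 0"
  shows "(q_int z n)\<^sup>2 * poly (metallic_discr n) z / poly (metallic_poly_t n) z ^ 2 \<notin> \<real>\<^sub>\<le>\<^sub>0"
proof
  let ?t = "poly (metallic_poly_t n) z"
  assume "(q_int z n)\<^sup>2 * poly (metallic_discr n) z / ?t ^ 2 \<in> \<real>\<^sub>\<le>\<^sub>0"
  then obtain x where x: "x \<le> 0" "(q_int z n)\<^sup>2 * poly (metallic_discr n) z / ?t ^ 2 = of_real x"
    by (auto elim: nonpos_Reals_cases)
  then have D: "(q_int z n)\<^sup>2 * poly (metallic_discr n) z = of_real x * ?t ^ 2"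
    using t_nz[OF assms(1)] by (simp add: divide_simps)
  then have "x \<noteq> 0" using assms q_int_nz by auto
  moreover have "4 * z ^ (2 * n) = of_real (1 - x) * ?t ^ 2"
    using D unfolding metallic_discr_eq_t by (simp add: algebra_simps power_mult)
  ultimately show False using t_avoids_ray[OF assms(1), of "1 - x"] x(1) by simp
qed

text \<open>Both \<open>w / e\<close> and \<open>w [n] / t\<close> have a real part that does not vanish along the segment from
  \<open>0\<close> to \<open>z\<close>, and both equal 1 at \<open>0\<close> for the same branch \<open>w\<close> of the square root.\<close>

lemma exists_branch:
  assumes z: "norm z \<le> R" "poly (metallic_discr n) z \<noteq> 0"
  obtains w where "w\<^sup>2 = poly (metallic_discr n) z" "Re (w / poly (metallic_poly_e n) z) > 0"
    "Re (w * q_int z n / poly (metallic_poly_t n) z) > 0"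
proof -
  let ?e = "poly (metallic_poly_e n)" and ?t = "poly (metallic_poly_t n)"
    and ?D = "poly (metallic_discr n)"
  \<comment> \<open>The branch is \<open>w = e f\<close>; then \<open>f = w / e\<close>, and
    \<open>g\<close> is \<open>w [n] / t\<close> for the same branch.\<close>
  define f where "f u = csqrt (?D u / ?e u ^ 2)" for u
  define g where "g u = ?e u * f u * q_int u n / ?t u" for u
  have f2: "(f u)\<^sup>2 = ?D u / ?e u ^ 2" for u by (simp add: f_def)
  have Re_nz: "Re v \<noteq> 0" if "v\<^sup>2 \<notin> \<real>\<^sub>\<le>\<^sub>0" for v :: complex
  proof
    assume "Re v = 0"
    then have "v\<^sup>2 = of_real (- (Im v)\<^sup>2)" by (simp add: complex_eq_iff power2_eq_square)
    then show False using that by (simp only: nonpos_Reals_of_real_iff) simp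
  qed
  have seg: "norm (of_real x * z) \<le> R" "?D (of_real x * z) \<noteq> 0" if "x \<in> {0..1}" for x
  proof -
    have "x * norm z \<le> 1 * norm z" using that by (intro mult_right_mono) auto
    then show "norm (of_real x * z) \<le> R" using that z(1) by (simp add: norm_mult)
    show "?D (of_real x * z) \<noteq> 0"
    proof (cases "x = 1")
      case False
      then have "x * norm z \<le> x * R" "x * R < 1 * R"
        using that z(1) R_pos by (auto intro: mult_left_mono)
      then show ?thesis using that by (intro discr_nz) (simp add: norm_mult)
    qed (use z in simp)
  qed
  have cont: "continuous_on {0..1} (\<lambda>x::real. Re (g (of_real x * z)))"
  proof -
    have q: "continuous_on A (\<lambda>u. q_int u n)" for A :: "complex set"
      unfolding q_int_def by (intro continuous_intros)
    have p: "continuous_on {0..1} (\<lambda>x::real. ?D (of_real x * z) / ?e (of_real x * z) ^ 2)"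
      using seg e_nz by (intro continuous_intros) auto
    have "continuous_on {0..1} (\<lambda>x::real. f (of_real x * z))"
      unfolding f_def
      by (rule continuous_on_compose2[OF continuous_on_csqrt p]) (use seg branch_not_nonpos_e in auto)
    moreover have "continuous_on {0..1} (\<lambda>x::real. q_int (of_real x * z) n)"
      by (rule continuous_on_compose2[OF q[of UNIV]]) (auto intro!: continuous_intros)
    ultimately show ?thesis
      unfolding g_def using seg t_nz by (intro continuous_intros) auto
  qed
  have g_nz: "Re (g (of_real x * z)) \<noteq> 0" if "x \<in> {0..1}" for x
  proof (rule Re_nz)
    let ?u = "of_real x * z"
    have "(g ?u)\<^sup>2 = (q_int ?u n)\<^sup>2 * ?D ?u / ?t ?u ^ 2"
      using e_nz[OF seg(1)[OF that]] by (simp add: g_def power_mult_distrib power_divide f2)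
    then show "(g ?u)\<^sup>2 \<notin> \<real>\<^sub>\<le>\<^sub>0" using branch_not_nonpos_t[OF seg[OF that]] by simp
  qed
  have "Re (g z) > 0"
  proof (rule ccontr)
    assume "\<not> Re (g z) > 0"
    moreover have "g 0 = 1" by (simp add: g_def f_def poly_at_0)
    ultimately obtain x where "0 \<le> x" "x \<le> 1" "Re (g (of_real x * z)) = 0"
      using IVT2'[of "\<lambda>x. Re (g (of_real x * z))" 1 0 0] cont by auto
    then show False using g_nz by simp
  qed
  moreover have "Re (f z) > 0"
    using Re_nz[of "f z"] branch_not_nonpos_e[OF z] f2 csqrt_principal unfolding f_def by metis
  ultimately show thesis
    using that[of "?e z * f z"] e_nz[OF z(1)] by (simp add: g_def power_mult_distrib f2)
qed

text \<open>At a zero of the discriminant \<mu> is a double eigenvalue, so the second component is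
  \<open>\<mu> ^ m\<close> times a linear function of \<open>m\<close>. The factor
  \<open>2 * \<mu>\<close> avoids the exponent \<open>m - 1\<close>.\<close>

lemma moebius_orbit_at_branch_point:
  assumes z: "norm z \<le> R" "poly (metallic_discr n) z = 0"
    and v: "fixed_point_form n z 0 v = x"
  defines "\<mu> \<equiv> poly (metallic_poly_t n) z / 2"
  defines "v' \<equiv> \<lambda>m. (moebius_step z (q_int z n) ((z ^ n)\<^sup>2) ^^ m) v"
  shows "fixed_point_form n z 0 (v' m) = \<mu> ^ m * x"
    and "2 * \<mu> * snd (v' m) = \<mu> ^ m * (2 * \<mu> * snd v + of_nat m * q_int z n * x)"
proof -
  show A: "fixed_point_form n z 0 (v' m) = \<mu> ^ m * x" for m
  proof (induction m)
    case (Suc m)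
    have "2 * fixed_point_form n z 0 (v' (Suc m)) = (2 * \<mu>) * fixed_point_form n z 0 (v' m)"
      using fixed_point_form_step[of 0 n z "v' m"] z by (simp add: v'_def \<mu>_def)
    then show ?case using Suc by simp
  qed (use v in \<open>simp add: v'_def\<close>)
  have step: "2 * snd (v' (Suc m)) = 2 * \<mu> * snd (v' m) + q_int z n * fixed_point_form n z 0 (v' m)" for m
  proof -
    have "2 * (\<beta> + z * h * \<alpha>) = (y\<^sup>2 + z * h\<^sup>2 + 1) * \<beta>
        + h * (2 * z * \<alpha> - ((z - 1) * (y + 1) + z * h + 0) * \<beta>)"
      if "(z - 1) * h = y - 1" for h y \<alpha> \<beta>
      using that by algebra
    from this[OF q_int_geometric] show ?thesis
      by (simp add: v'_def moebius_step_def \<mu>_def fixed_point_form_def poly_metallic_poly_t)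
  qed
  show "2 * \<mu> * snd (v' m) = \<mu> ^ m * (2 * \<mu> * snd v + of_nat m * q_int z n * x)"
  proof (induction m)
    case (Suc m)
    have "2 * \<mu> * snd (v' (Suc m)) = \<mu> * (2 * snd (v' (Suc m)))" by simp
    also have "\<dots> = \<mu> * (2 * \<mu> * snd (v' m)) + \<mu> * q_int z n * (\<mu> ^ m * x)"
      unfolding step A by (simp add: algebra_simps)
    also have "\<dots> = \<mu> ^ Suc m * (2 * \<mu> * snd v + of_nat (Suc m) * q_int z n * x)"
      unfolding Suc by (simp add: algebra_simps)
    finally show ?case .
  qed (simp add: v'_def)
qed

lemma moebius_orbit_nonzero:
  fixes z :: complex
  assumes z: "norm z \<le> R"
    and v: "v = (q_int z n, 1) \<or> v = ((q_int z n)\<^sup>2 + z ^ (2 * n - 1), q_int z n)"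
  shows "snd ((moebius_step z (q_int z n) ((z ^ n)\<^sup>2) ^^ m) v) \<noteq> 0"
proof (cases "poly (metallic_discr n) z = 0")
  case False
  obtain w where w: "w\<^sup>2 = poly (metallic_discr n) z" "Re (w / poly (metallic_poly_e n) z) > 0"
    "Re (w * q_int z n / poly (metallic_poly_t n) z) > 0"
    using exists_branch[OF z False] .
  show ?thesis
  proof (rule moebius_orbit_snd_nonzero[OF w(1) t_nz[OF z] w(3)])
    show "norm (fixed_point_form n z w v) < norm (fixed_point_form n z (- w) v)"
      using v norm_diff_less_norm_add[OF w(2) e_nz[OF z]] norm_diff_less_norm_add[OF w(3) t_nz[OF z]]
      by (auto simp: fixed_point_form_odd_start fixed_point_form_even_start[OF n] simp del: One_nat_def)
  qed
next
  case True
  \<comment> \<open>Both fixed points coincide, so comparing moduli gives nothing. The closed form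
    leaves the factor \<open>1 + m (1 - \<mu>)\<close> for the odd start, nonzero as
    \<open>|\<mu>| = |z| ^ n < 1\<close>, and \<open>1 + m\<close> for the even one.\<close>
  define \<mu> where "\<mu> = poly (metallic_poly_t n) z / 2"
  let ?h = "q_int z n"
  have \<mu>2: "\<mu>\<^sup>2 = (z ^ n)\<^sup>2"
    using metallic_discr_eq_t[of z n] True by (simp add: \<mu>_def power_divide)
  have \<mu>0: "\<mu> \<noteq> 0" using t_nz[OF z] by (simp add: \<mu>_def)
  have "norm \<mu> = norm z ^ n"
    using \<mu>2 by (metis norm_ge_zero norm_power power2_eq_imp_eq zero_le_power)
  then have \<mu>1: "norm \<mu> < 1" using z R1 n by (simp add: power_less_one_iff)
  have pos: "1 + of_nat m * (1 - \<mu>) \<noteq> 0"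
  proof -
    have "Re \<mu> < 1" using \<mu>1 complex_Re_le_cmod[of \<mu>] by linarith
    then have "0 \<le> real m * (1 - Re \<mu>)" by simp
    then have "Re (1 + of_nat m * (1 - \<mu>)) > 0" by simp
    then show ?thesis by (metis less_irrefl zero_complex.sel(1))
  qed
  note orb = moebius_orbit_at_branch_point(2)[OF z True refl, folded \<mu>_def, of m v]
  from v show ?thesis
  proof
    assume v: "v = (q_int z n, 1)"
    have "?h * fixed_point_form n z 0 v = 2 * \<mu> - 2 * \<mu>\<^sup>2"
      unfolding \<mu>2 using metallic_poly_e_eq_t[of z n] v
      by (simp add: fixed_point_form_odd_start \<mu>_def)
    then have "of_nat m * (?h * fixed_point_form n z 0 v) = of_nat m * (2 * \<mu> - 2 * \<mu>\<^sup>2)"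
      by simp
    then have "2 * \<mu> + of_nat m * ?h * fixed_point_form n z 0 v = 2 * \<mu> * (1 + of_nat m * (1 - \<mu>))"
      by (simp add: algebra_simps power2_eq_square)
    then show ?thesis using orb v \<mu>0 pos by auto
  next
    assume v: "v = ((q_int z n)\<^sup>2 + z ^ (2 * n - 1), q_int z n)"
    then have "fixed_point_form n z 0 v = 2 * \<mu>"
      using fixed_point_form_even_start[OF n, of z 0] by (simp add: \<mu>_def)
    then have "2 * \<mu> * snd v + of_nat m * ?h * fixed_point_form n z 0 v = 2 * \<mu> * ?h * (1 + of_nat m)"
      using v by (simp add: algebra_simps)
    moreover have "(1 + of_nat m :: complex) \<noteq> 0" by (metis of_nat_Suc of_nat_neq_0)
    ultimately show ?thesis using orb \<mu>0 q_int_nz[OF z] by auto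
  qed
qed

text \<open>At a double zero, \<open>D = e\<^sup>2 + 4 q ^ (2n+1)\<close> would force
  \<open>2 z0 e'(z0) / e(z0) = 2n + 1\<close>, against the strict bound for zero-free discs.\<close>

lemma discr_simple_root: "poly (pderiv (metallic_discr n)) z0 \<noteq> 0"
proof
  assume "poly (pderiv (metallic_discr n)) z0 = 0"
  let ?e = "metallic_poly_e n"
  have e: "poly ?e z0 \<noteq> 0" using e_nz z0 by simp
  have "4 * z0 ^ (2 * n + 1) = - (poly ?e z0 ^ 2)"
    using z0 by (simp add: metallic_discr_def poly_monom add_eq_0_iff)
  moreover have "z0 * poly (pderiv (metallic_discr n)) z0
      = 2 * poly ?e z0 * (z0 * poly (pderiv ?e) z0) + of_nat (2 * n + 1) * (4 * z0 ^ (2 * n + 1))"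
    by (simp add: metallic_discr_def pderiv_add pderiv_power pderiv_monom poly_monom algebra_simps
        power2_eq_square pderiv_mult)
  ultimately have "poly ?e z0 ^ 2 * (2 * (z0 * poly (pderiv ?e) z0 / poly ?e z0) - of_nat (2 * n + 1)) = 0"
    using \<open>poly (pderiv (metallic_discr n)) z0 = 0\<close> e by (simp add: field_simps power2_eq_square)
  then have "2 * (z0 * poly (pderiv ?e) z0 / poly ?e z0) = of_nat (2 * n + 1)"
    using e by simp
  then have "2 * Re (z0 * poly (pderiv ?e) z0 / poly ?e z0) = real (2 * n + 1)"
    by (metis complex_Re_of_nat mult_2 plus_complex.sel(1))
  moreover have "2 * Re (z0 * poly (pderiv ?e) z0 / poly ?e z0) < real (2 * n + 1)"
    using z0 e_nz degree_metallic_poly_e[of n] by (intro Re_log_deriv_zero_free_disc) auto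
  ultimately show False by simp
qed

text \<open>Inside the disc of convergence \<open>E = 2 q M - b\<close> is a holomorphic square root
  of the discriminant. Were \<open>z0\<close> inside, the discriminant would have a multiple zero
  there.\<close>

lemma metallic_conv_radius_le: "fps_conv_radius (metallic_fps n) \<le> R"
proof (rule ccontr)
  let ?M = "metallic_fps n"
  assume "\<not> ?thesis"
  then have R: "ereal R < fps_conv_radius ?M" by simp
  define b where "b = [:-1, 1:] * (monom 1 n + 1) + [:0, 1:] * q_int_poly n"
  define E where "E z = 2 * z * eval_fps ?M z - poly b z" for z
  have "fps_of_poly [:-1, 1:] = (fps_X - 1 :: complex fps)"
    by (simp add: fps_of_poly_pCons flip: fps_const_neg)
  then have b: "fps_of_poly b = (fps_X - 1) * (fps_X ^ n + 1) + fps_X * q_int_fps n"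
    unfolding b_def fps_of_poly_add fps_of_poly_mult
    by (simp add: fps_of_poly_add fps_of_poly_monom' fps_of_poly_pCons)
  have Mq: "z * eval_fps ?M z ^ 2 - poly b z * eval_fps ?M z - 1 = 0" if z: "norm z < fps_conv_radius ?M" for z
  proof -
    have M2: "norm z < fps_conv_radius (?M ^ 2)"
      using z fps_conv_radius_power[of ?M 2] by (rule less_le_trans)
    have 1: "norm z < fps_conv_radius (fps_X * ?M ^ 2)"
      using M2 fps_conv_radius_mult[of fps_X "?M ^ 2"] by (auto intro: less_le_trans)
    have 2: "norm z < fps_conv_radius (fps_of_poly b * ?M)"
      using z fps_conv_radius_mult[of "fps_of_poly b" ?M] by (auto intro: less_le_trans)
    have 3: "norm z < fps_conv_radius (fps_X * ?M ^ 2 - fps_of_poly b * ?M)"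
      by (rule less_le_trans[OF _ fps_conv_radius_diff]) (use 1 2 in simp)
    have "eval_fps (fps_X * ?M ^ 2 - fps_of_poly b * ?M - 1) z = 0"
      using metallic_fps_quadratic[OF n] by (simp add: b)
    then show ?thesis
      using z M2 1 2 3 by (simp add: eval_fps_diff eval_fps_mult eval_fps_power)
  qed
  have bz: "poly b z = (z - 1) * (z ^ n + 1) + z * q_int z n" for z
    by (simp add: b_def poly_monom algebra_simps)
  have E2: "E z ^ 2 = poly (metallic_discr n) z" if "norm z < fps_conv_radius ?M" for z
  proof -
    have "E z ^ 2 = 4 * z * (z * eval_fps ?M z ^ 2 - poly b z * eval_fps ?M z - 1) + (poly b z)\<^sup>2 + 4 * z"
      by (simp add: E_def algebra_simps power2_eq_square)
    then show ?thesis using Mq[OF that] by (simp add: poly_metallic_discr' bz)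
  qed
  define U where "U = eball (0 :: complex) (fps_conv_radius ?M)"
  have U: "open U" "z0 \<in> U" using R z0 by (simp_all add: U_def)
  have "E holomorphic_on U"
    unfolding E_def U_def by (intro holomorphic_intros) auto
  then have "(E has_field_derivative deriv E z0) (at z0)"
    using U holomorphic_derivI by blast
  then have "((\<lambda>z. E z ^ 2) has_field_derivative 2 * E z0 * deriv E z0) (at z0)"
    by (auto intro!: derivative_eq_intros)
  then have "(poly (metallic_discr n) has_field_derivative 2 * E z0 * deriv E z0) (at z0)"
    by (rule has_field_derivative_transform_within_open[OF _ U]) (use E2 in \<open>simp add: U_def\<close>)
  moreover have "E z0 = 0" using E2[of z0] R z0 by simp
  ultimately have "poly (pderiv (metallic_discr n)) z0 = 0"
    using DERIV_unique[OF poly_DERIV[of "metallic_discr n" z0]] by fastforce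
  then show False using discr_simple_root by simp
qed

end

subsection \<open>Finite metallic fractions\<close>

lemma fps_conv_radius_rational_function:
  fixes p d :: "complex poly"
  assumes nz: "\<And>z. norm z \<le> R \<Longrightarrow> poly d z \<noteq> 0" and "0 \<le> R"
  shows "ereal R < fps_conv_radius (fps_of_poly p * inverse (fps_of_poly d))"
proof -
  let ?S = "{z. poly d z = 0}"
  \<comment> \<open>The finitely many poles leave room beyond \<open>R\<close>; \<open>R + 1\<close>
    covers a denominator without zeros.\<close>
  define R' where "R' = Min (insert (R + 1) (norm ` ?S))"
  have "d \<noteq> 0" using nz[of 0] \<open>0 \<le> R\<close> by auto
  then have fin: "finite (insert (R + 1) (norm ` ?S))" using poly_roots_finite by auto
  have "R < R'" unfolding R'_def using fin nz by (subst Min_gr_iff) (auto simp: not_le[symmetric])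
  have nz': "poly d z \<noteq> 0" if "norm z < R'" for z
  proof
    assume "poly d z = 0"
    then have "R' \<le> norm z" unfolding R'_def using fin by (intro Min_le) auto
    then show False using that by simp
  qed
  have "poly p has_fps_expansion fps_of_poly p" "poly d has_fps_expansion fps_of_poly d"
    by (simp_all add: has_fps_expansion_def)
  moreover have "fps_nth (fps_of_poly d) 0 \<noteq> 0"
    using nz[of 0] \<open>0 \<le> R\<close> by (simp add: poly_0_coeff_0)
  ultimately have "(\<lambda>z. poly p z * inverse (poly d z)) has_fps_expansion
      fps_of_poly p * inverse (fps_of_poly d)"
    by (intro has_fps_expansion_mult has_fps_expansion_inverse)
  then have "fps_conv_radius (fps_of_poly p * inverse (fps_of_poly d)) \<ge> R'"
    by (rule holomorphic_on_imp_fps_conv_radius_ge) (auto intro!: holomorphic_intros nz')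
  then show ?thesis using \<open>R < R'\<close> by (meson ereal_less_ereal_Ex less_ereal.simps(1) less_le_trans)
qed

section \<open>Iterates as quotients of polynomials\<close>

abbreviation fps_quotient :: "complex poly \<times> complex poly \<Rightarrow> complex fps" where
  "fps_quotient v \<equiv> fps_of_poly (fst v) * inverse (fps_of_poly (snd v))"

abbreviation poly_step :: "nat \<Rightarrow> complex poly \<times> complex poly \<Rightarrow> complex poly \<times> complex poly" where
  "poly_step n \<equiv> moebius_step [:0, 1:] (q_int_poly n) (monom 1 (2 * n))"

lemma q_step_fps_quotient:
  assumes "coeff (snd v) 0 \<noteq> 0"
  shows "q_step n n (fps_quotient v) = fps_quotient (poly_step n v)"
proof -
  let ?P = "fps_of_poly (fst v)" and ?Q = "fps_of_poly (snd v)" and ?h = "q_int_fps n"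
  define Q' where "Q' = ?Q + fps_X * ?h * ?P"
  have Q: "?Q * inverse ?Q = 1" using assms by (simp add: inverse_mult_eq_1')
  have Q': "Q' * inverse Q' = 1" using assms by (simp add: Q'_def inverse_mult_eq_1')
  have "1 + fps_X * ?h * (?P * inverse ?Q) = Q' * inverse ?Q"
    using Q by (simp add: Q'_def distrib_right mult.assoc)
  then have "inverse (1 + fps_X * ?h * (?P * inverse ?Q)) = inverse Q' * ?Q"
    using assms by (simp add: fps_inverse_mult fps_inverse_idempotent)
  then have "q_step n n (fps_quotient v)
      = ?h + fps_X ^ (n + n) * ?P * (inverse ?Q * ?Q) * inverse Q'"
    by (simp add: q_step_def ac_simps)
  also have "\<dots> = (?h * Q' + fps_X ^ (n + n) * ?P) * inverse Q'"
    using Q Q' by (simp add: distrib_right mult.assoc mult.commute[of "inverse ?Q"])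
  finally show ?thesis
    by (simp add: moebius_step_def Q'_def fps_of_poly_add fps_of_poly_mult fps_of_poly_monom'
        fps_of_poly_pCons mult_2 ac_simps)
qed

lemma poly_step_iterate_coeff_0: "coeff (snd ((poly_step n ^^ m) v)) 0 = coeff (snd v) 0"
  by (induction m) (simp_all add: moebius_step_def)

lemma q_step_iterate_fps_quotient:
  assumes "coeff (snd v) 0 \<noteq> 0"
  shows "(q_step n n ^^ m) (fps_quotient v) = fps_quotient ((poly_step n ^^ m) v)"
proof (induction m)
  case (Suc m)
  have "coeff (snd ((poly_step n ^^ m) v)) 0 \<noteq> 0" using assms poly_step_iterate_coeff_0 by metis
  then show ?case using Suc q_step_fps_quotient by simp
qed simp

lemma poly_poly_step_iterate:
  "map_prod (\<lambda>p. poly p z) (\<lambda>p. poly p z) ((poly_step n ^^ m) v)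
    = (moebius_step z (q_int z n) ((z ^ n)\<^sup>2) ^^ m) (map_prod (\<lambda>p. poly p z) (\<lambda>p. poly p z) v)"
proof (induction m)
  case (Suc m)
  show ?case
    unfolding funpow.simps o_apply Suc[symmetric]
    by (simp add: moebius_step_def poly_monom power_mult mult.commute)
qed simp

lemma cfrac_Cons: "as \<noteq> [] \<Longrightarrow> cfrac (a # as) = of_nat a + 1 / cfrac as"
  by (cases as) auto

text \<open>For odd \<open>k\<close> this produces the even-length expansion, whose last pair
  deforms to \<open>[n - 1] + q ^ (n - 1) = [n]\<close>.\<close>

lemma cfrac_append_split_last:
  assumes "n \<ge> 1"
  shows "cfrac (as @ [n]) = cfrac (as @ [n - 1, 1])"
proof (induction as)
  case Nil
  show ?case using assms by (simp add: of_nat_diff)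
next
  case (Cons a as)
  then show ?case by (simp add: cfrac_Cons)
qed

lemma q_fps_split_last:
  assumes "n \<ge> 1"
  shows "q_fps [n - 1, 1] = q_int_fps n"
proof -
  have 1: "q_int_poly 1 = 1" by (simp add: q_int_poly_def)
  have "q_int_poly n = q_int_poly (n - 1) + monom 1 (n - 1)"
    using assms by (cases n) (simp_all add: q_int_poly_def)
  then show ?thesis using 1 by (simp add: fps_of_poly_add fps_of_poly_monom')
qed

lemma q_fps_double:
  assumes "n \<ge> 1"
  shows "q_fps [n, n] = fps_quotient (q_int_poly n ^ 2 + monom 1 (2 * n - 1), q_int_poly n)"
proof -
  have "q_int_fps n * inverse (q_int_fps n) = 1"
    using coeff_q_int_poly_0[OF assms] by (simp add: inverse_mult_eq_1')
  then show ?thesis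
    by (simp add: fps_of_poly_add fps_of_poly_power fps_of_poly_monom' distrib_right
        fps_of_poly_mult power2_eq_square mult.assoc mult_2)
qed

context branch_radius begin

lemma fps_conv_radius_iterate:
  assumes v: "v = (q_int_poly n, 1) \<or> v = (q_int_poly n ^ 2 + monom 1 (2 * n - 1), q_int_poly n)"
  shows "ereal R < fps_conv_radius ((q_step n n ^^ m) (fps_quotient v))"
proof -
  have "coeff (snd v) 0 \<noteq> 0" using v coeff_q_int_poly_0[OF n] by auto
  then have eq: "(q_step n n ^^ m) (fps_quotient v) = fps_quotient ((poly_step n ^^ m) v)"
    by (rule q_step_iterate_fps_quotient)
  show ?thesis unfolding eq
  proof (rule fps_conv_radius_rational_function)
    fix z :: complex assume z: "norm z \<le> R"
    let ?e = "\<lambda>p. poly p z"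
    have "map_prod ?e ?e v = (q_int z n, 1) \<or>
        map_prod ?e ?e v = ((q_int z n)\<^sup>2 + z ^ (2 * n - 1), q_int z n)"
      using v by (auto simp: poly_monom)
    from moebius_orbit_nonzero[OF z this, of m]
    show "poly (snd ((poly_step n ^^ m) v)) z \<noteq> 0"
      unfolding poly_poly_step_iterate[symmetric] by simp
  qed (use R_pos in simp)
qed

lemma q_rational_conv_radius:
  assumes "n \<ge> 2" "k \<ge> 1"
  shows "ereal R < fps_conv_radius (q_rational (cfrac (replicate k n)))"
proof (cases "even k")
  case True
  then obtain m where k: "k = 2 * Suc m" using assms by (cases "k div 2") (auto elim!: evenE)
  have "replicate k n = replicate (2 * m) n @ [n, n]"
    by (simp add: k replicate_append_same[symmetric] flip: replicate_add)
  then have "q_rational (cfrac (replicate k n)) = (q_step n n ^^ m) (q_fps [n, n])"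
    using n by (simp only: q_rational_cfrac expansion_replicate_append q_fps_replicate_append expansion_pair)
  then show ?thesis using fps_conv_radius_iterate q_fps_double[OF n] by metis
next
  case False
  then obtain m where k: "k = 2 * m + 1" by (elim oddE)
  have "replicate k n = replicate (2 * m) n @ [n]"
    by (simp add: k replicate_append_same)
  then have "cfrac (replicate k n) = cfrac (replicate (2 * m) n @ [n - 1, 1])"
    using cfrac_append_split_last[OF n] by metis
  moreover have "expansion [n - 1, 1]" using assms by simp
  ultimately have "q_rational (cfrac (replicate k n)) = (q_step n n ^^ m) (q_fps [n - 1, 1])"
    using n by (metis q_rational_cfrac expansion_replicate_append q_fps_replicate_append)
  also have "q_fps [n - 1, 1] = fps_quotient (q_int_poly n, 1)"
    using q_fps_split_last[OF n] by simp
  finally show ?thesis using fps_conv_radius_iterate by metis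
qed

end

subsection \<open>Small zeros of the discriminant\<close>

text \<open>With \<open>x = Re z\<close> and \<open>r = |z|\<^sup>2\<close>, completing the square
  gives \<open>|1 - z + z\<^sup>2|\<^sup>2 = 3/4 (1 - r)\<^sup>2 + (2 x - (1 + r) /
  2)\<^sup>2\<close>; 43/50 is a rational just below \<open>sqrt 3 / 2\<close>.\<close>

lemma norm_quadratic_ge:
  fixes z :: complex
  shows "43 / 50 * (1 - (norm z)\<^sup>2) \<le> norm (1 - z + z\<^sup>2)"
proof (cases "(norm z)\<^sup>2 \<le> 1")
  case True
  define x r where "x = Re z" and "r = (norm z)\<^sup>2"
  have y2: "(Im z)\<^sup>2 = r - x\<^sup>2" by (simp add: x_def r_def cmod_power2)
  have "(norm (1 - z + z\<^sup>2))\<^sup>2 = (1 - x + (x\<^sup>2 - (Im z)\<^sup>2))\<^sup>2 + (Im z)\<^sup>2 * (2 * x - 1)\<^sup>2"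
    unfolding cmod_power2 by (simp add: x_def power2_eq_square algebra_simps)
  also have "\<dots> = 3 / 4 * (1 - r)\<^sup>2 + (2 * x - (1 + r) / 2)\<^sup>2"
    unfolding y2 by (simp add: power2_eq_square field_simps)
  finally have "3 / 4 * (1 - r)\<^sup>2 \<le> (norm (1 - z + z\<^sup>2))\<^sup>2" by simp
  moreover have "(43 / 50 * (1 - r))\<^sup>2 \<le> 3 / 4 * (1 - r)\<^sup>2"
    unfolding power_mult_distrib by (intro mult_right_mono) (simp_all add: power2_eq_square)
  ultimately have "(43 / 50 * (1 - r))\<^sup>2 \<le> (norm (1 - z + z\<^sup>2))\<^sup>2" by linarith
  then show ?thesis unfolding r_def by (rule power2_le_imp_le) simp
next
  case False
  then have "43 / 50 * (1 - (norm z)\<^sup>2) \<le> 0" by simp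
  then show ?thesis using norm_ge_zero order_trans by blast
qed

text \<open>Multiplied by \<open>1 - q\<close> and \<open>(1 - q)\<^sup>2\<close>, the polynomials \<open>e\<close> and \<open>t\<close> take the common form
  \<open>(1 - q + q\<^sup>2) (1 + u) - 2 q\<^bsup>n+1\<^esup>\<close> with \<open>u = q\<^sup>n\<close> and \<open>u = q\<^bsup>2n\<^esup>\<close>.\<close>

lemma small_disc_nonzero:
  fixes z u :: complex
  assumes z: "norm z \<le> \<rho>" "\<rho> < 1" and u: "norm u \<le> \<rho> ^ n"
    and \<rho>: "2 * \<rho> ^ (n + 1) < 43 / 50 * (1 - \<rho>\<^sup>2) * (1 - \<rho> ^ n)"
  shows "(1 - z + z\<^sup>2) * (1 + u) \<noteq> 2 * z * z ^ n"
proof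
  assume eq: "(1 - z + z\<^sup>2) * (1 + u) = 2 * z * z ^ n"
  have \<rho>0: "0 \<le> \<rho>" using z(1) norm_ge_zero order_trans by blast
  have "(norm z)\<^sup>2 \<le> \<rho>\<^sup>2" using z by (simp add: power_mono)
  then have "43 / 50 * (1 - \<rho>\<^sup>2) \<le> norm (1 - z + z\<^sup>2)"
    by (intro order_trans[OF _ norm_quadratic_ge]) simp
  moreover have "1 - \<rho> ^ n \<le> norm (1 + u)" using norm_diff_ineq[of 1 u] u by simp
  moreover have "0 \<le> 1 - \<rho> ^ n" using \<rho>0 z by (simp add: power_le_one)
  ultimately have "43 / 50 * (1 - \<rho>\<^sup>2) * (1 - \<rho> ^ n) \<le> norm (1 - z + z\<^sup>2) * norm (1 + u)"
    by (intro mult_mono) auto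
  also have "\<dots> = 2 * norm z ^ (n + 1)" using eq by (simp flip: norm_mult) (simp add: norm_mult norm_power)
  also have "\<dots> \<le> 2 * \<rho> ^ (n + 1)" using z by (intro mult_left_mono power_mono) auto
  finally show False using \<rho> by simp
qed

lemma
  fixes z :: complex
  assumes z: "norm z \<le> \<rho>" "\<rho> < 1"
    and \<rho>: "2 * \<rho> ^ (n + 1) < 43 / 50 * (1 - \<rho>\<^sup>2) * (1 - \<rho> ^ n)"
  shows metallic_poly_e_nonzero: "poly (metallic_poly_e n) z \<noteq> 0"
    and metallic_poly_t_nonzero: "poly (metallic_poly_t n) z \<noteq> 0"
proof -
  have \<rho>0: "0 \<le> \<rho>" using z(1) norm_ge_zero order_trans by blast
  have zn: "norm (z ^ n) \<le> \<rho> ^ n" using z by (simp add: norm_power power_mono)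
  moreover have "\<rho> ^ n \<le> 1" using \<rho>0 z by (simp add: power_le_one)
  ultimately have "norm (z ^ n) * norm (z ^ n) \<le> norm (z ^ n)" by (intro mult_left_le) auto
  then have zn2: "norm ((z ^ n)\<^sup>2) \<le> \<rho> ^ n"
    using zn by (simp only: power2_eq_square norm_mult)
  have e: "(1 - z) * (z * h - (z - 1) * (y + 1)) = (1 - z + z\<^sup>2) * (1 + y) - 2 * z * y"
    and t: "(1 - z)\<^sup>2 * (y\<^sup>2 + z * h\<^sup>2 + 1) = (1 - z + z\<^sup>2) * (1 + y\<^sup>2) - 2 * z * y"
    if "(z - 1) * h = y - 1" for h y
    using that by algebra+
  show "poly (metallic_poly_e n) z \<noteq> 0"
    using small_disc_nonzero[OF z zn \<rho>] e[OF q_int_geometric, of n]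
    unfolding poly_metallic_poly_e by auto
  show "poly (metallic_poly_t n) z \<noteq> 0"
    using small_disc_nonzero[OF z zn2 \<rho>] t[OF q_int_geometric, of n]
    unfolding poly_metallic_poly_t by auto
qed

text \<open>The zero \<open>w\<close> forces the smallest zero modulus to be at most \<rho>, and the
  numerical inequality keeps \<open>e\<close> and \<open>t\<close> zero-free up to \<rho>.\<close>

lemma exists_branch_radius:
  assumes "n \<ge> 1" "\<rho> < 1" "2 * \<rho> ^ (n + 1) < 43 / 50 * (1 - \<rho>\<^sup>2) * (1 - \<rho> ^ n)"
    and w: "poly (metallic_discr n) w = 0" "norm w \<le> \<rho>"
  obtains R z0 where "branch_radius n R z0"
proof -
  let ?S = "{z. poly (metallic_discr n) z = 0}"
  have "poly (metallic_discr n) 0 \<noteq> 0"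
    using assms(1) by (cases n) (simp_all add: poly_metallic_discr poly_metallic_poly_e q_int_Suc')
  then have "metallic_discr n \<noteq> 0" by auto
  then have fin: "finite (norm ` ?S)" using poly_roots_finite by blast
  define R where "R = Min (norm ` ?S)"
  have "R \<in> norm ` ?S" unfolding R_def using fin w by (intro Min_in) auto
  then obtain z0 where z0: "norm z0 = R" "poly (metallic_discr n) z0 = 0" by auto
  have min: "R \<le> norm z" if "poly (metallic_discr n) z = 0" for z
    unfolding R_def using fin that by (intro Min_le) auto
  have "R \<le> \<rho>" using min[OF w(1)] w(2) by simp
  then have "branch_radius n R z0"
    using assms z0 min metallic_poly_e_nonzero[of _ \<rho> n] metallic_poly_t_nonzero[of _ \<rho> n]
    by unfold_locales (auto simp: not_less[symmetric])
  then show thesis by (rule that)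
qed

section \<open>Locating a zero for n = 3 and n = 4 by rational arithmetic\<close>

lemma numeral_eq_Complex: "numeral k = Complex (numeral k) 0"
  by (simp add: complex_eq_iff)

lemmas Complex_arith = numeral_eq_Complex one_complex.code zero_complex.code

lemma q_int_poly_3: "q_int_poly 3 = [:1, 1, 1:]" and q_int_poly_4: "q_int_poly 4 = [:1, 1, 1, 1:]"
  by (simp_all add: q_int_poly_def numeral_eq_Suc monom_Suc monom_0)

lemma metallic_discr_3: "metallic_discr 3 = [:1, 0, 2, 4, -1, 4, 2, 0, 1:]"
  unfolding metallic_discr_def metallic_poly_e_def q_int_poly_3
  by (simp add: numeral_eq_Suc monom_Suc monom_0 one_pCons power2_eq_square)

lemma metallic_discr_4: "metallic_discr 4 = [:1, 0, 2, 2, 5, 0, 5, 2, 2, 0, 1:]"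
  unfolding metallic_discr_def metallic_poly_e_def q_int_poly_4
  by (simp add: numeral_eq_Suc monom_Suc monom_0 one_pCons power2_eq_square)

lemma metallic_discr_3_root: "\<exists>w. poly (metallic_discr 3) w = 0 \<and> norm w \<le> 13 / 20"
proof -
  \<comment> \<open>An approximate zero of modulus just under 3/5; the error 1/20 leads to
    13/20.\<close>
  let ?z = "Complex (3 / 20) (29 / 50)"
  have "(8 * norm (poly (metallic_discr 3) ?z))\<^sup>2 < (1 / 20 * norm (poly (pderiv (metallic_discr 3)) ?z))\<^sup>2"
    unfolding metallic_discr_3 power_mult_distrib
    by (simp add: pderiv_pCons Complex_arith cmod_power2) (simp add: power2_eq_square)
  then have "8 * norm (poly (metallic_discr 3) ?z) < 1 / 20 * norm (poly (pderiv (metallic_discr 3)) ?z)"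
    by (rule power_less_imp_less_base) simp
  moreover have "degree (metallic_discr 3) = 8" "metallic_discr 3 \<noteq> 0" by (simp_all add: metallic_discr_3)
  ultimately obtain w where w: "poly (metallic_discr 3) w = 0" "norm (?z - w) < 1 / 20"
    using exists_root_near[of "metallic_discr 3" "1 / 20" ?z] by auto
  have "(norm ?z)\<^sup>2 \<le> (3 / 5)\<^sup>2" unfolding cmod_power2 by (simp add: power2_eq_square)
  then have "norm ?z \<le> 3 / 5" by (rule power2_le_imp_le) simp
  then have "norm w \<le> 13 / 20" using norm_triangle_ineq4[of ?z "?z - w"] w(2) by simp
  then show ?thesis using w(1) by blast
qed

lemma metallic_discr_4_root: "\<exists>w. poly (metallic_discr 4) w = 0 \<and> norm w \<le> 67 / 100"
proof -
  \<comment> \<open>A finer approximation with error 1/100, since \<rho> = 7/10 would already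
    violate the inequality required for \<open>n = 4\<close>.\<close>
  let ?z = "Complex (3 / 10) (577 / 1000)"
  have "(10 * norm (poly (metallic_discr 4) ?z))\<^sup>2 < (1 / 100 * norm (poly (pderiv (metallic_discr 4)) ?z))\<^sup>2"
    unfolding metallic_discr_4 power_mult_distrib
    by (simp add: pderiv_pCons Complex_arith cmod_power2) (simp add: power2_eq_square)
  then have "10 * norm (poly (metallic_discr 4) ?z) < 1 / 100 * norm (poly (pderiv (metallic_discr 4)) ?z)"
    by (rule power_less_imp_less_base) simp
  moreover have "degree (metallic_discr 4) = 10" "metallic_discr 4 \<noteq> 0" by (simp_all add: metallic_discr_4)
  ultimately obtain w where w: "poly (metallic_discr 4) w = 0" "norm (?z - w) < 1 / 100"
    using exists_root_near[of "metallic_discr 4" "1 / 100" ?z] by auto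
  have "(norm ?z)\<^sup>2 \<le> (66 / 100)\<^sup>2" unfolding cmod_power2 by (simp add: power2_eq_square)
  then have "norm ?z \<le> 66 / 100" by (rule power2_le_imp_le) simp
  then have "norm w \<le> 67 / 100" using norm_triangle_ineq4[of ?z "?z - w"] w(2) by simp
  then show ?thesis using w(1) by blast
qed

theorem theorem1p4:
  fixes n k :: nat
  assumes "n \<in> {3, 4}" and "k \<ge> 1"
  shows "fps_conv_radius (q_rational (cfrac (replicate k n)))
       > fps_conv_radius (q_irrational (metallic n))"
proof -
  \<comment> \<open>The radius \<rho> must be large enough to reach a zero of the discriminant and
    small enough to exclude zeros of \<open>e\<close> and \<open>t\<close>.\<close>
  obtain \<rho> w where \<rho>: "\<rho> < 1" "2 * \<rho> ^ (n + 1) < 43 / 50 * (1 - \<rho>\<^sup>2) * (1 - \<rho> ^ n)"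
    "poly (metallic_discr n) w = 0" "norm w \<le> \<rho>"
  proof (cases "n = 3")
    case True
    obtain w where "poly (metallic_discr 3) w = 0" "norm w \<le> 13 / 20"
      using metallic_discr_3_root by blast
    moreover have "2 * (13 / 20) ^ (3 + 1) < 43 / 50 * (1 - (13 / 20)\<^sup>2) * (1 - (13 / 20 :: real) ^ 3)"
      by (simp add: power2_eq_square eval_nat_numeral)
    moreover have "n = 3" using True by simp
    ultimately show thesis by (intro that[of "13 / 20" w]) simp_all
  next
    case False
    obtain w where "poly (metallic_discr 4) w = 0" "norm w \<le> 67 / 100"
      using metallic_discr_4_root by blast
    moreover have "2 * (67 / 100) ^ (4 + 1) < 43 / 50 * (1 - (67 / 100)\<^sup>2) * (1 - (67 / 100 :: real) ^ 4)"
      by (simp add: power2_eq_square eval_nat_numeral)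
    moreover have "n = 4" using assms(1) False by simp
    ultimately show thesis by (intro that[of "67 / 100" w]) simp_all
  qed
  then obtain R z0 where "branch_radius n R z0"
    using exists_branch_radius[OF _ \<rho>] assms(1) by force
  then interpret branch_radius n R z0 .
  have "fps_conv_radius (q_irrational (metallic n)) \<le> R"
    using metallic_conv_radius_le n by (simp add: q_irrational_metallic)
  also have "ereal R < fps_conv_radius (q_rational (cfrac (replicate k n)))"
    using assms by (intro q_rational_conv_radius) auto
  finally show ?thesis .
qed

end
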